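(* Let $\Bbbk$ be a field, $n\geq 1$ and $q\in\Bbbk^{\times}$, $q\neq 1$. Then the bt-algebra $\mathcal E_n(q)$ is isomorphic to the $\Bbbk$-algebra generated by $\{g_1,\dots,g_{n-1}\}$ and $\{\overline e(A)\mid A\in\mathrm{SetPar}_n\}$ subject to the relations \begin{align*} &\sum_{A\in\mathrm{SetPar}_n}\overline e(A)=1,\\ &\overline e(A)\overline e(B)=\delta_{AB}\,\overline e(A) &&\text{for all }A,B\in\mathrm{SetPar}_n,\\ &g_a\overline e(A)=\overline e(\sigma_aA)g_a &&\text{for all }1\le a<n,\ A\in\mathrm{SetPar}_n,\\ &g_a^2\,\overline e(A)=q\,\overline e(A) &&\text{if }a\not\sim_A(a+1),\\ &g_a^2\,\overline e(A)=(q+(q-1)g_a)\,\overline e(A) &&\text{if }a\sim_A(a+1),\\ &g_ag_bg_a=g_bg_ag_b &&\text{for }|a-b|=1,\\ &g_ag_b=g_bg_a &&\text{for }|a-b|>1. \end{align*}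
   Context: $\mathrm{SetPar}_n$ is the set of set partitions of $\{1,\dots,n\}$; for $A\in\mathrm{SetPar}_n$, $a\sim_Ab$ means $a,b$ lie in the same block of $A$. $\sigma_a=(a,a+1)\in\mathfrak S_n$ acts on $\mathrm{SetPar}_n$ by permuting elements of $\{1,\dots,n\}$. The bt-algebra (braids and ties algebra) $\mathcal E_n(q)$ is the unital associative $\Bbbk$-algebra generated by $g_1,\dots,g_{n-1}$, $e_1,\dots,e_{n-1}$ with relations: $g_ae_a=e_ag_a$ for all $a$; $g_ag_bg_a=g_bg_ag_b$ for $|a-b|=1$; $g_ag_b=g_bg_a$ for $|a-b|>1$; $e_ag_bg_a=g_bg_ae_b$ for $|a-b|=1$; $e_ae_bg_b=e_ag_be_a=g_be_ae_b$ for $|a-b|=1$; $e_ae_b=e_be_a$ for all $a,b$; $g_ae_b=e_bg_a$ for $|a-b|>1$; $e_a^2=e_a$ for all $a$; $g_a^2=q+(q-1)e_ag_a$ for all $a$. *)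

theory Defs
  imports "HOL-Algebra.QuotRing" "HOL-Algebra.Module" "HOL-Library.Poly_Mapping"
    "HOL-Library.Disjoint_Sets" "HOL-Combinatorics.Transposition"
begin

section \<open>Free algebras and algebras given by generators and relations\<close>

text \<open>
  Words in an alphabet form the free monoid, written additively so that
  the finitely supported functions on words with values in a field
  become the free associative unital algebra: the multiplication of
  \<^type>\<open>poly_mapping\<close> is convolution with respect to concatenation.
\<close>

datatype 'g fword = Word (letters: "'g list")

instantiation fword :: (type) monoid_add
begin

definition zero_fword :: "'g fword" where
  "zero_fword = Word []"

definition plus_fword :: "'g fword \<Rightarrow> 'g fword \<Rightarrow> 'g fword" where
  "plus_fword u v = Word (letters u @ letters v)"

instance
  by standard (simp_all add: zero_fword_def plus_fword_def)

end

definition gen :: "'g \<Rightarrow> 'g fword \<Rightarrow>\<^sub>0 'k::field" where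
  "gen x = Poly_Mapping.single (Word [x]) 1"

definition scal :: "'k \<Rightarrow> 'g fword \<Rightarrow>\<^sub>0 'k::field" where
  "scal c = Poly_Mapping.single 0 c"

text \<open>
  The generating set \<open>X\<close> is a parameter rather than a type, since it will depend on a
  natural number. Algebras are represented by the record type \<^typ>\<open>('k, 'a) module\<close>,
  which consists of a ring and a scalar multiplication; the ground field is the type \<open>'k\<close>.
  (The locale \<^locale>\<open>algebra\<close> only covers commutative algebras.)
\<close>

definition free_algebra :: "'g set \<Rightarrow> ('k::field, 'g fword \<Rightarrow>\<^sub>0 'k) module" where
  "free_algebra X =
     \<lparr>carrier = {p. \<forall>w \<in> Poly_Mapping.keys p. set (letters w) \<subseteq> X},
      mult = (*), one = 1, zero = 0, add = (+), smult = (\<lambda>c p. scal c * p)\<rparr>"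

definition quotient_algebra :: "('k, 'a) module \<Rightarrow> 'a set \<Rightarrow> ('k, 'a set) module" where
  "quotient_algebra A I =
     ring.extend (A Quot I) (module.fields (\<lambda>c C. \<Union>x\<in>C. I +>\<^bsub>A\<^esub> (c \<odot>\<^bsub>A\<^esub> x)))"

text \<open>A pair \<open>(l, r)\<close> in \<open>R\<close> stands for the relation \<open>l = r\<close>.\<close>

definition presented_algebra ::
    "'g set \<Rightarrow> (('g fword \<Rightarrow>\<^sub>0 'k) \<times> ('g fword \<Rightarrow>\<^sub>0 'k)) set \<Rightarrow>
     ('k::field, ('g fword \<Rightarrow>\<^sub>0 'k) set) module" where
  "presented_algebra X R =
     quotient_algebra (free_algebra X) (Idl\<^bsub>free_algebra X\<^esub> {l - r |l r. (l, r) \<in> R})"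

definition algebra_iso :: "('k, 'a) module \<Rightarrow> ('k, 'b) module \<Rightarrow> ('a \<Rightarrow> 'b) set" where
  "algebra_iso A B =
     {h \<in> ring_iso A B. \<forall>c. \<forall>x \<in> carrier A. h (c \<odot>\<^bsub>A\<^esub> x) = c \<odot>\<^bsub>B\<^esub> h x}"

definition is_algebra_iso :: "('k, 'a) module \<Rightarrow> ('k, 'b) module \<Rightarrow> bool"
    (infix \<open>\<simeq>\<^sub>a\<^sub>l\<^sub>g\<close> 60) where
  "A \<simeq>\<^sub>a\<^sub>l\<^sub>g B \<longleftrightarrow> algebra_iso A B \<noteq> {}"

lemma free_algebra_simps:
  "p \<in> carrier (free_algebra X) \<longleftrightarrow> (\<forall>w \<in> Poly_Mapping.keys p. set (letters w) \<subseteq> X)"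
  "p \<otimes>\<^bsub>free_algebra X\<^esub> q = p * q" "\<one>\<^bsub>free_algebra X\<^esub> = 1"
  "p \<oplus>\<^bsub>free_algebra X\<^esub> q = p + q" "\<zero>\<^bsub>free_algebra X\<^esub> = 0"
  "c \<odot>\<^bsub>free_algebra X\<^esub> p = scal c * p"
  by (simp_all add: free_algebra_def)

lemma free_algebra_closed:
  "p \<in> carrier (free_algebra X) \<Longrightarrow> q \<in> carrier (free_algebra X) \<Longrightarrow>
     p + q \<in> carrier (free_algebra X)"
  "p \<in> carrier (free_algebra X) \<Longrightarrow> q \<in> carrier (free_algebra X) \<Longrightarrow>
     p - q \<in> carrier (free_algebra X)"
  "p \<in> carrier (free_algebra X) \<Longrightarrow> q \<in> carrier (free_algebra X) \<Longrightarrow>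
     p * q \<in> carrier (free_algebra X)"
  "p \<in> carrier (free_algebra X) \<Longrightarrow> - p \<in> carrier (free_algebra X)"
  "0 \<in> carrier (free_algebra X)" "1 \<in> carrier (free_algebra X)"
  "scal c \<in> carrier (free_algebra X)"
  "gen x \<in> carrier (free_algebra X) \<longleftrightarrow> x \<in> X"
proof -
  show "p + q \<in> carrier (free_algebra X)"
    if "p \<in> carrier (free_algebra X)" "q \<in> carrier (free_algebra X)"
    using that keys_add[of p q] unfolding free_algebra_simps by blast
  show "p - q \<in> carrier (free_algebra X)"
    if "p \<in> carrier (free_algebra X)" "q \<in> carrier (free_algebra X)"
    using that keys_diff[of p q] unfolding free_algebra_simps by blast
  show "p * q \<in> carrier (free_algebra X)"
    if "p \<in> carrier (free_algebra X)" "q \<in> carrier (free_algebra X)"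
    unfolding free_algebra_simps
  proof
    fix w assume "w \<in> Poly_Mapping.keys (p * q)"
    then obtain u v where "u \<in> Poly_Mapping.keys p" "v \<in> Poly_Mapping.keys q" "w = u + v"
      using keys_mult[of p q] by blast
    with that show "set (letters w) \<subseteq> X"
      unfolding free_algebra_simps by (simp add: plus_fword_def)
  qed
qed (simp_all add: free_algebra_simps zero_fword_def scal_def gen_def)

lemma ring_free_algebra: "ring (free_algebra X)"
proof (rule ringI)
  show "abelian_group (free_algebra X)"
  proof (rule abelian_groupI)
    fix p assume "p \<in> carrier (free_algebra X)"
    then show "\<exists>r\<in>carrier (free_algebra X). r \<oplus>\<^bsub>free_algebra X\<^esub> p = \<zero>\<^bsub>free_algebra X\<^esub>"
      by (intro bexI[of _ "- p"])
         (simp_all only: free_algebra_simps(2-) free_algebra_closed, simp)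
  qed (simp_all only: free_algebra_simps(2-) free_algebra_closed ac_simps add_0_left add_0_right)
  show "monoid (free_algebra X)"
    by (rule monoidI)
       (simp_all only: free_algebra_simps(2-) free_algebra_closed mult.assoc mult_1_left mult_1_right)
qed (simp_all only: free_algebra_simps(2-) distrib_left distrib_right)

text \<open>On quotients, scalar multiplication is computed on representatives.\<close>

lemma smult_quotient_algebra:
  assumes I: "ideal I (free_algebra X)" and p: "p \<in> carrier (free_algebra X)"
  shows "c \<odot>\<^bsub>quotient_algebra (free_algebra X) I\<^esub> (I +>\<^bsub>free_algebra X\<^esub> p) =
         I +>\<^bsub>free_algebra X\<^esub> (scal c * p)"
proof -
  interpret ideal I "free_algebra X" by (rule I)
  have "I +>\<^bsub>free_algebra X\<^esub> (scal c * x) = I +>\<^bsub>free_algebra X\<^esub> (scal c * p)"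
    if x: "x \<in> I +>\<^bsub>free_algebra X\<^esub> p" for x
  proof -
    obtain i where i: "i \<in> I" "x = i + p"
      using x by (auto simp: a_r_coset_def' free_algebra_simps)
    have "scal c * i \<in> I"
      using I_l_closed[OF i(1), of "scal c"] by (simp add: free_algebra_simps(2) free_algebra_closed)
    then have "scal c * x \<in> I +>\<^bsub>free_algebra X\<^esub> (scal c * p)"
      by (auto simp: a_r_coset_def' free_algebra_simps i(2) distrib_left)
    moreover have "scal c * p \<in> carrier (free_algebra X)"
      using p by (simp add: free_algebra_closed)
    ultimately show ?thesis
      by (rule a_repr_independence'[symmetric])
  qed
  moreover have "p \<in> I +>\<^bsub>free_algebra X\<^esub> p"
    by (rule a_rcos_self[OF p])
  ultimately have "(\<Union>x\<in>I +>\<^bsub>free_algebra X\<^esub> p. I +>\<^bsub>free_algebra X\<^esub> (scal c * x)) =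
      I +>\<^bsub>free_algebra X\<^esub> (scal c * p)"
    by blast
  then show ?thesis
    by (simp add: quotient_algebra_def ring.defs module.defs free_algebra_simps)
qed

section \<open>Set partitions\<close>

definition set_par :: "nat \<Rightarrow> nat set set set" where
  "set_par n = {A. partition_on {1..n} A}"

definition same_block :: "nat set set \<Rightarrow> nat \<Rightarrow> nat \<Rightarrow> bool" where
  "same_block A a b \<longleftrightarrow> (\<exists>S\<in>A. a \<in> S \<and> b \<in> S)"

definition sigma_act :: "nat \<Rightarrow> nat set set \<Rightarrow> nat set set" where
  "sigma_act a A = (\<lambda>S. transpose a (a + 1) ` S) ` A"

section \<open>The two presentations\<close>

text \<open>
  The ties \<open>e\<^sub>a\<close> of the first presentation are indexed by numbers,
  the orthogonal idempotents of the second one by set partitions.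
\<close>

datatype 'e bt_gen = Braid nat | Tie 'e

abbreviation gg :: "nat \<Rightarrow> 'e bt_gen fword \<Rightarrow>\<^sub>0 'k::field" where
  "gg a \<equiv> gen (Braid a)"

abbreviation ee :: "'e \<Rightarrow> 'e bt_gen fword \<Rightarrow>\<^sub>0 'k::field" where
  "ee i \<equiv> gen (Tie i)"

definition adjacent :: "nat \<Rightarrow> nat \<Rightarrow> bool" where
  "adjacent a b \<longleftrightarrow> \<bar>int a - int b\<bar> = 1"

definition distant :: "nat \<Rightarrow> nat \<Rightarrow> bool" where
  "distant a b \<longleftrightarrow> \<bar>int a - int b\<bar> > 1"

definition bt_gens :: "nat \<Rightarrow> nat bt_gen set" where
  "bt_gens n = Braid ` {1..<n} \<union> Tie ` {1..<n}"

definition bt_rels ::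
    "nat \<Rightarrow> 'k::field \<Rightarrow> ((nat bt_gen fword \<Rightarrow>\<^sub>0 'k) \<times> (nat bt_gen fword \<Rightarrow>\<^sub>0 'k)) set" where
  "bt_rels n q =
     {(gg a * ee a, ee a * gg a) |a. a \<in> {1..<n}} \<union>
     {(gg a * gg b * gg a, gg b * gg a * gg b) |a b.
        a \<in> {1..<n} \<and> b \<in> {1..<n} \<and> adjacent a b} \<union>
     {(gg a * gg b, gg b * gg a) |a b. a \<in> {1..<n} \<and> b \<in> {1..<n} \<and> distant a b} \<union>
     {(ee a * gg b * gg a, gg b * gg a * ee b) |a b.
        a \<in> {1..<n} \<and> b \<in> {1..<n} \<and> adjacent a b} \<union>
     {(ee a * ee b * gg b, ee a * gg b * ee a) |a b.
        a \<in> {1..<n} \<and> b \<in> {1..<n} \<and> adjacent a b} \<union>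
     {(ee a * gg b * ee a, gg b * ee a * ee b) |a b.
        a \<in> {1..<n} \<and> b \<in> {1..<n} \<and> adjacent a b} \<union>
     {(ee a * ee b, ee b * ee a) |a b. a \<in> {1..<n} \<and> b \<in> {1..<n}} \<union>
     {(gg a * ee b, ee b * gg a) |a b. a \<in> {1..<n} \<and> b \<in> {1..<n} \<and> distant a b} \<union>
     {((ee a)^2, ee a) |a. a \<in> {1..<n}} \<union>
     {((gg a)^2, scal q + scal (q - 1) * ee a * gg a) |a. a \<in> {1..<n}}"

definition bt_algebra ::
    "nat \<Rightarrow> 'k::field \<Rightarrow> ('k, (nat bt_gen fword \<Rightarrow>\<^sub>0 'k) set) module" where
  "bt_algebra n q = presented_algebra (bt_gens n) (bt_rels n q)"

definition idem_gens :: "nat \<Rightarrow> nat set set bt_gen set" where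
  "idem_gens n = Braid ` {1..<n} \<union> Tie ` set_par n"

definition idem_rels ::
    "nat \<Rightarrow> 'k::field \<Rightarrow>
     ((nat set set bt_gen fword \<Rightarrow>\<^sub>0 'k) \<times> (nat set set bt_gen fword \<Rightarrow>\<^sub>0 'k)) set" where
  "idem_rels n q =
     {(\<Sum>A\<in>set_par n. ee A, 1)} \<union>
     {(ee A * ee B, if A = B then ee A else 0) |A B. A \<in> set_par n \<and> B \<in> set_par n} \<union>
     {(gg a * ee A, ee (sigma_act a A) * gg a) |a A. a \<in> {1..<n} \<and> A \<in> set_par n} \<union>
     {((gg a)^2 * ee A, scal q * ee A) |a A.
        a \<in> {1..<n} \<and> A \<in> set_par n \<and> \<not> same_block A a (a + 1)} \<union>
     {((gg a)^2 * ee A, (scal q + scal (q - 1) * gg a) * ee A) |a A.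
        a \<in> {1..<n} \<and> A \<in> set_par n \<and> same_block A a (a + 1)} \<union>
     {(gg a * gg b * gg a, gg b * gg a * gg b) |a b.
        a \<in> {1..<n} \<and> b \<in> {1..<n} \<and> adjacent a b} \<union>
     {(gg a * gg b, gg b * gg a) |a b. a \<in> {1..<n} \<and> b \<in> {1..<n} \<and> distant a b}"

definition idem_algebra ::
    "nat \<Rightarrow> 'k::field \<Rightarrow> ('k, (nat set set bt_gen fword \<Rightarrow>\<^sub>0 'k) set) module" where
  "idem_algebra n q = presented_algebra (idem_gens n) (idem_rels n q)"

text \<open>
  All relators lie in the respective free algebra. This matters because
  \<^const>\<open>genideal\<close> is only meaningful for subsets of the carrier.
\<close>

lemma sigma_act_set_par:
  assumes "A \<in> set_par n" "a \<in> {1..<n}"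
  shows "sigma_act a A \<in> set_par n"
proof -
  have "transpose a (a + 1) ` {1..n} = {1..n}"
    using assms(2) by (intro transpose_image_eq) simp
  moreover have "partition_on (transpose a (a + 1) ` {1..n}) ((`) (transpose a (a + 1)) ` A - {{}})"
    using assms(1) by (intro partition_on_inj_image) (auto simp: set_par_def inj_on_def transpose_eq_iff)
  moreover have "(`) (transpose a (a + 1)) ` A - {{}} = sigma_act a A"
    using assms(1) unfolding set_par_def sigma_act_def partition_on_def by blast
  ultimately show ?thesis
    by (simp add: set_par_def)
qed

lemma sum_free_algebra_closed:
  assumes "\<And>i. i \<in> S \<Longrightarrow> f i \<in> carrier (free_algebra X)"
  shows "sum f S \<in> carrier (free_algebra X)"
  using assms
  by (induction S rule: infinite_finite_induct) (simp_all add: free_algebra_closed)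

lemma bt_rels_carrier:
  "(l, r) \<in> bt_rels n q \<Longrightarrow> l - r \<in> carrier (free_algebra (bt_gens n))"
  unfolding bt_rels_def
  by (elim UnE CollectE exE conjE)
     (simp_all add: free_algebra_closed bt_gens_def power2_eq_square)

lemma idem_rels_carrier:
  "(l, r) \<in> idem_rels n q \<Longrightarrow> l - r \<in> carrier (free_algebra (idem_gens n))"
  unfolding idem_rels_def
  by (elim UnE CollectE exE conjE)
     (simp_all add: free_algebra_closed sum_free_algebra_closed sigma_act_set_par
        idem_gens_def power2_eq_square image_iff)

end

theory Submission
  imports Defs "HOL-Algebra.UnivPoly"
begin

text \<open>
  Both presentations describe the same configuration of elements in a ring, and the
  isomorphism exchanges two ways of recording it. One records a commuting idempotent
  \<open>tie i j\<close> for every pair of points, to be read as the indicator of the event that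
  \<open>i\<close> and \<open>j\<close> lie in the same block; the other records the atoms of the Boolean algebra
  that these idempotents generate, which are indexed by set partitions.

  Start with elements that satisfy the relations of the bt-algebra. The quadratic relation reads
  \<open>g\<^sub>a (g\<^sub>a - (q - 1) e\<^sub>a) = q\<close>, hence \<open>g\<^sub>a\<close> is invertible because \<open>q \<noteq> 0\<close>; let \<open>T\<^sub>a\<close> be
  conjugation by \<open>g\<^sub>a\<close>. The other relations say that the conjugates of the \<open>e\<^sub>a\<close> are permuted
  by the \<open>T\<^sub>a\<close> in the same way as unordered pairs of points are permuted by the transpositions
  \<open>\<sigma>\<^sub>a = (a, a + 1)\<close>. So there is a family \<open>tie i j\<close> with \<open>tie a (a + 1) = e\<^sub>a\<close>
  and \<open>T\<^sub>a (tie i j) = tie (\<sigma>\<^sub>a i) (\<sigma>\<^sub>a j)\<close> (lemma \<open>T_tie\<close>), and facts about ties can be proved for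
  neighbours and transported by conjugation. In this way one obtains that ties are
  idempotent, that they are transitive, \<open>tie i j \<cdot> tie j k = tie i j \<cdot> tie i k\<close>
  (lemma \<open>tie_trans\<close>), and that they commute (lemma \<open>tie_commute\<close>). Commutation rests on
  \<open>q \<noteq> 1\<close>: since \<open>T\<^sub>a\<^sup>2\<close> fixes all ties, the square \<open>g\<^sub>a\<^sup>2 = q + (q - 1) e\<^sub>a g\<^sub>a\<close> commutes with
  them, and so does \<open>e\<^sub>a g\<^sub>a\<close> because the coefficient \<open>q - 1\<close> can be cancelled.

  For each set \<open>S\<close> of pairs let the atom of \<open>S\<close> be the product over all pairs of \<open>tie i j\<close> or
  \<open>1 - tie i j\<close>, depending on whether the pair is in \<open>S\<close>. The atoms are orthogonal
  idempotents with sum \<open>1\<close>. By transitivity the atom of \<open>S\<close> vanishes unless \<open>S\<close> is an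
  equivalence relation; what remains is one idempotent for each set partition, and
  these satisfy the second set of relations (lemma \<open>partition_idem_family\<close>). This is
  Moebius inversion on the partition lattice, in product form.

  Conversely, if orthogonal idempotents \<open>f A\<close> are given, put \<open>e\<^sub>a\<close> equal to the sum of those
  \<open>f A\<close> for which \<open>a\<close> and \<open>a + 1\<close> lie in the same block of \<open>A\<close>. Products of such partial sums
  are computed blockwise, and the relations of the bt-algebra become statements about
  partitions (lemma \<open>joined_family\<close>). The two passages undo each other (lemmas
  \<open>sum_partition_idem_eq_e\<close> and \<open>partition_idem_joined\<close>). As they are carried out in arbitrary
  rings, the universal property of presented algebras yields homomorphisms in both
  directions, and these are mutually inverse because they are so on generators.
\<close>

section \<open>Evaluating noncommutative polynomials\<close>

lemma poly_mapping_sum_induct [case_names zero single add]: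
  fixes p :: "'a \<Rightarrow>\<^sub>0 'b::comm_monoid_add"
  assumes "P 0" and "\<And>w c. P (Poly_Mapping.single w c)" and "\<And>p q. P p \<Longrightarrow> P q \<Longrightarrow> P (p + q)"
  shows "P p"
proof (induction p rule: update_induct)
  case const
  show ?case by (rule assms(1))
next
  case (update f a b)
  have "Poly_Mapping.update a b f = f + Poly_Mapping.single a b"
    using update.hyps(1)
    by (intro poly_mapping_eqI) (auto simp: lookup_update lookup_add lookup_single in_keys_iff when_def)
  then show ?case
    using assms(2,3) update by metis
qed

text \<open>
  The structure of an algebra over a field enters only through the central ring homomorphism
  that sends a scalar to its multiple of the unit. In this form algebras are ordinary
  rings, so everything below applies to a quotient ring without a
  scalar multiplication being attached to it first.
\<close>

locale scalar_ring = ring R for R (structure) +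
  fixes sc :: "'k::field \<Rightarrow> 'a"
  assumes sc_closed [simp]: "sc c \<in> carrier R"
    and sc_add: "sc (c + d) = sc c \<oplus> sc d"
    and sc_mult: "sc (c * d) = sc c \<otimes> sc d"
    and sc_one: "sc 1 = \<one>"
    and sc_central: "x \<in> carrier R \<Longrightarrow> sc c \<otimes> x = x \<otimes> sc c"
begin

lemma sc_zero [simp]: "sc 0 = \<zero>"
proof -
  have "sc 0 \<oplus> sc 0 = sc 0"
    using sc_add[of 0 0] by simp
  then show ?thesis
    using add.l_cancel_one[of "sc 0" "sc 0"] by simp
qed

definition word :: "('g \<Rightarrow> 'a) \<Rightarrow> 'g list \<Rightarrow> 'a" where
  "word f xs = foldr (\<lambda>x y. f x \<otimes> y) xs \<one>"

definition eval :: "('g \<Rightarrow> 'a) \<Rightarrow> ('g fword \<Rightarrow>\<^sub>0 'k) \<Rightarrow> 'a" where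
  "eval f p = (\<Oplus>w\<in>Poly_Mapping.keys p. sc (Poly_Mapping.lookup p w) \<otimes> word f (letters w))"

lemma word_closed [simp]: "f \<in> UNIV \<rightarrow> carrier R \<Longrightarrow> word f xs \<in> carrier R"
  by (induction xs) (auto simp: word_def)

lemma word_append: "f \<in> UNIV \<rightarrow> carrier R \<Longrightarrow> word f (xs @ ys) = word f xs \<otimes> word f ys"
proof (induction xs)
  case Nil
  show ?case
    using word_closed[OF Nil, of ys] by (simp add: word_def)
next
  case (Cons x xs)
  then show ?case
    using word_closed[OF Cons.prems] by (simp add: word_def Pi_iff m_assoc)
qed

lemma eval_superset:
  assumes "f \<in> UNIV \<rightarrow> carrier R" "finite S" "Poly_Mapping.keys p \<subseteq> S"
  shows "eval f p = (\<Oplus>w\<in>S. sc (Poly_Mapping.lookup p w) \<otimes> word f (letters w))"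
  unfolding eval_def
  using assms by (intro add.finprod_mono_neutral_cong_left) (auto simp: in_keys_iff)

lemma eval_closed [simp]: "f \<in> UNIV \<rightarrow> carrier R \<Longrightarrow> eval f p \<in> carrier R"
  unfolding eval_def by (intro finsum_closed) auto

lemma eval_add:
  assumes f: "f \<in> UNIV \<rightarrow> carrier R"
  shows "eval f (p + q) = eval f p \<oplus> eval f q"
proof -
  let ?S = "Poly_Mapping.keys p \<union> Poly_Mapping.keys q"
  have "eval f (p + q) = (\<Oplus>w\<in>?S. sc (Poly_Mapping.lookup (p + q) w) \<otimes> word f (letters w))"
    using f keys_add[of p q] by (intro eval_superset) auto
  also have "\<dots> = (\<Oplus>w\<in>?S. sc (Poly_Mapping.lookup p w) \<otimes> word f (letters w) \<oplus>
                       sc (Poly_Mapping.lookup q w) \<otimes> word f (letters w))"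
    using f by (intro finsum_cong') (auto simp: lookup_add sc_add l_distr)
  also have "\<dots> = (\<Oplus>w\<in>?S. sc (Poly_Mapping.lookup p w) \<otimes> word f (letters w)) \<oplus>
                  (\<Oplus>w\<in>?S. sc (Poly_Mapping.lookup q w) \<otimes> word f (letters w))"
    using f by (intro finsum_addf) auto
  also have "\<dots> = eval f p \<oplus> eval f q"
    using f by (simp add: eval_superset[of f ?S])
  finally show ?thesis .
qed

lemma eval_zero [simp]: "eval f 0 = \<zero>"
  by (simp add: eval_def)

lemma eval_single:
  assumes "f \<in> UNIV \<rightarrow> carrier R"
  shows "eval f (Poly_Mapping.single w c) = sc c \<otimes> word f (letters w)"
  using assms by (subst eval_superset[of f "{w}"]) auto

lemma eval_scal [simp]: "f \<in> UNIV \<rightarrow> carrier R \<Longrightarrow> eval f (scal c) = sc c"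
  by (simp add: scal_def eval_single zero_fword_def word_def)

lemma eval_gen [simp]: "f \<in> UNIV \<rightarrow> carrier R \<Longrightarrow> eval f (gen x) = f x"
  by (simp add: gen_def eval_single word_def sc_one Pi_iff)

lemma eval_mult:
  assumes f: "f \<in> UNIV \<rightarrow> carrier R"
  shows "eval f (p * q) = eval f p \<otimes> eval f q"
proof (induction p rule: poly_mapping_sum_induct)
  case zero
  show ?case using f by simp
next
  case (single v c)
  show ?case
  proof (induction q rule: poly_mapping_sum_induct)
    case zero
    show ?case using f by simp
  next
    case (single w d)
    have [simp]: "word f xs \<in> carrier R" for xs
      using f by simp
    have "eval f (Poly_Mapping.single v c * Poly_Mapping.single w d) =
        (sc c \<otimes> sc d) \<otimes> (word f (letters v) \<otimes> word f (letters w))"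
      using f by (simp add: mult_single eval_single plus_fword_def word_append sc_mult)
    also have "\<dots> = (sc c \<otimes> word f (letters v)) \<otimes> (sc d \<otimes> word f (letters w))"
    proof -
      have "sc d \<otimes> (word f (letters v) \<otimes> word f (letters w)) =
          word f (letters v) \<otimes> (sc d \<otimes> word f (letters w))"
        using sc_central[of "word f (letters v)" d] by (simp flip: m_assoc)
      then show ?thesis
        by (simp add: m_assoc)
    qed
    finally show ?case
      using f by (simp add: eval_single)
  next
    case (add p q)
    then show ?case using f by (simp add: distrib_left eval_add r_distr)
  qed
next
  case (add p q)
  then show ?case using f by (simp add: distrib_right eval_add l_distr)
qed

lemma eval_one: "f \<in> UNIV \<rightarrow> carrier R \<Longrightarrow> eval f 1 = \<one>"
  using eval_scal[of f 1] by (simp add: scal_def sc_one)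

lemma eval_ring_hom: "f \<in> UNIV \<rightarrow> carrier R \<Longrightarrow> eval f \<in> ring_hom (free_algebra X) R"
  by (intro ring_hom_memI) (simp_all add: free_algebra_simps eval_add eval_mult eval_one)

end

text \<open>
  Evaluation homomorphisms and the residue class map of a quotient are both instances.
  Hence each system of relations has to be translated into equations between elements only
  once, for an arbitrary \<open>\<kappa>\<close>.
\<close>

locale free_algebra_rep = scalar_ring R sc for R (structure) and sc :: "'k::field \<Rightarrow> 'a" +
  fixes X :: "'g set" and \<kappa> :: "('g fword \<Rightarrow>\<^sub>0 'k) \<Rightarrow> 'a"
  assumes rep_hom: "\<kappa> \<in> ring_hom (free_algebra X) R"
    and rep_scal: "\<kappa> (scal c) = sc c"
begin

sublocale rep: ring_hom_ring "free_algebra X" R \<kappa>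
  by (intro ring_hom_ringI2 ring_free_algebra ring_axioms rep_hom)

lemma rep_closed [simp]: "p \<in> carrier (free_algebra X) \<Longrightarrow> \<kappa> p \<in> carrier R"
  by (rule rep.hom_closed)

lemma rep_ops [simp]:
  "p \<in> carrier (free_algebra X) \<Longrightarrow> q \<in> carrier (free_algebra X) \<Longrightarrow> \<kappa> (p + q) = \<kappa> p \<oplus> \<kappa> q"
  "p \<in> carrier (free_algebra X) \<Longrightarrow> q \<in> carrier (free_algebra X) \<Longrightarrow> \<kappa> (p * q) = \<kappa> p \<otimes> \<kappa> q"
  "\<kappa> 1 = \<one>" "\<kappa> 0 = \<zero>"
  using rep.hom_add[of p q] rep.hom_mult[of p q] rep.hom_one rep.hom_zero
  by (simp_all add: free_algebra_simps(2-))

lemma rep_diff: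
  assumes "p \<in> carrier (free_algebra X)" "q \<in> carrier (free_algebra X)"
  shows "\<kappa> (p - q) = \<kappa> p \<ominus> \<kappa> q"
proof -
  have pq: "p - q \<in> carrier (free_algebra X)"
    using assms by (rule free_algebra_closed)
  have "\<kappa> (p - q) \<oplus> \<kappa> q = \<kappa> p"
    using rep_ops(1)[OF pq assms(2)] by simp
  moreover have "\<kappa> (p - q) = (\<kappa> (p - q) \<oplus> \<kappa> q) \<ominus> \<kappa> q"
    using pq assms by (simp add: a_minus_def a_assoc r_neg)
  ultimately show ?thesis by simp
qed

lemma rep_sum:
  "finite S \<Longrightarrow> (\<And>i. i \<in> S \<Longrightarrow> p i \<in> carrier (free_algebra X)) \<Longrightarrow>
     \<kappa> (sum p S) = (\<Oplus>i\<in>S. \<kappa> (p i))"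
  by (induction S rule: finite_induct) (auto simp: sum_free_algebra_closed)

text \<open>
  A representation is determined by its values on generators, because
  every polynomial is a linear combination of words.
\<close>

lemma rep_eq_eval:
  assumes f: "f \<in> UNIV \<rightarrow> carrier R" and gens: "\<And>x. x \<in> X \<Longrightarrow> \<kappa> (gen x) = f x"
    and p: "p \<in> carrier (free_algebra X)"
  shows "\<kappa> p = eval f p"
proof -
  have word: "(Poly_Mapping.single (Word xs) 1 :: 'g fword \<Rightarrow>\<^sub>0 'k) \<in> carrier (free_algebra X) \<and>
      \<kappa> (Poly_Mapping.single (Word xs) 1) = word f xs" if "set xs \<subseteq> X" for xs
    using that
  proof (induction xs)
    case Nil
    have "Poly_Mapping.single (Word []) 1 = (1 :: 'g fword \<Rightarrow>\<^sub>0 'k)"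
      by (simp flip: zero_fword_def)
    then show ?case
      by (simp add: word_def free_algebra_closed)
  next
    case (Cons x xs)
    have "Poly_Mapping.single (Word (x # xs)) 1 = gen x * (Poly_Mapping.single (Word xs) 1 :: 'g fword \<Rightarrow>\<^sub>0 'k)"
      by (simp add: gen_def mult_single plus_fword_def)
    with Cons show ?case
      by (simp add: word_def free_algebra_closed gens)
  qed
  have "p = (\<Sum>w\<in>Poly_Mapping.keys p. scal (Poly_Mapping.lookup p w) * Poly_Mapping.single w 1)"
    by (intro poly_mapping_eqI)
       (auto simp: scal_def mult_single lookup_sum lookup_single when_def in_keys_iff)
  then have "\<kappa> p = \<kappa> (\<Sum>w\<in>Poly_Mapping.keys p. scal (Poly_Mapping.lookup p w) * Poly_Mapping.single w 1)"
    by simp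
  also have "\<dots> = (\<Oplus>w\<in>Poly_Mapping.keys p. \<kappa> (scal (Poly_Mapping.lookup p w) * Poly_Mapping.single w 1))"
    using p by (intro rep_sum) (auto simp: free_algebra_simps scal_def mult_single)
  also have "\<dots> = eval f p"
    unfolding eval_def
  proof (intro finsum_cong')
    fix w assume "w \<in> Poly_Mapping.keys p"
    then have "set (letters w) \<subseteq> X"
      using p by (auto simp: free_algebra_simps)
    from word[OF this]
    show "\<kappa> (scal (Poly_Mapping.lookup p w) * Poly_Mapping.single w 1) =
        sc (Poly_Mapping.lookup p w) \<otimes> word f (letters w)"
      by (simp add: free_algebra_closed rep_scal)
  qed (use f in auto)
  finally show ?thesis .
qed

end

section \<open>The universal property of a presented algebra\<close>

lemma scal_add: "scal (c + d) = scal c + scal d"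
  and scal_mult: "scal (c * d) = scal c * scal d"
  by (simp_all add: scal_def single_add mult_single)

locale presentation =
  fixes X :: "'g set" and Rel :: "(('g fword \<Rightarrow>\<^sub>0 'k::field) \<times> ('g fword \<Rightarrow>\<^sub>0 'k)) set"
  assumes rel_carrier: "(l, r) \<in> Rel \<Longrightarrow> l \<in> carrier (free_algebra X) \<and> r \<in> carrier (free_algebra X)"
begin

abbreviation "F \<equiv> free_algebra X :: ('k, 'g fword \<Rightarrow>\<^sub>0 'k) module"

definition I :: "('g fword \<Rightarrow>\<^sub>0 'k) set" where
  "I = Idl\<^bsub>F\<^esub> {l - r |l r. (l, r) \<in> Rel}"

abbreviation "Q \<equiv> F Quot I"

definition cls :: "('g fword \<Rightarrow>\<^sub>0 'k) \<Rightarrow> ('g fword \<Rightarrow>\<^sub>0 'k) set" where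
  "cls p = I +>\<^bsub>F\<^esub> p"

sublocale free: ring F
  by (rule ring_free_algebra)

lemma relators_carrier: "{l - r |l r. (l, r) \<in> Rel} \<subseteq> carrier F"
  using rel_carrier by (auto intro: free_algebra_closed)

sublocale rel_ideal: ideal I F
  unfolding I_def by (rule free.genideal_ideal[OF relators_carrier])

lemma cls_hom: "cls \<in> ring_hom F Q"
  unfolding cls_def by (rule rel_ideal.rcos_ring_hom)

sublocale cls: free_algebra_rep Q "\<lambda>c. cls (scal c)" X cls
proof -
  interpret Q: ring Q
    by (rule rel_ideal.quotient_is_ring)
  have "cls (scal (c + d)) = cls (scal c) \<oplus>\<^bsub>Q\<^esub> cls (scal d)" for c d
    using ring_hom_add[OF cls_hom, of "scal c" "scal d"]
    by (simp add: free_algebra_closed free_algebra_simps(4) scal_add)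
  moreover have "cls (scal (c * d)) = cls (scal c) \<otimes>\<^bsub>Q\<^esub> cls (scal d)" for c d
    using ring_hom_mult[OF cls_hom, of "scal c" "scal d"]
    by (simp add: free_algebra_closed free_algebra_simps(2) scal_mult)
  moreover have "cls (scal 1) = \<one>\<^bsub>Q\<^esub>"
    using ring_hom_one[OF cls_hom] by (simp add: free_algebra_simps scal_def)
  moreover have "cls (scal c) \<otimes>\<^bsub>Q\<^esub> x = x \<otimes>\<^bsub>Q\<^esub> cls (scal c)" if x: "x \<in> carrier Q" for x c
  proof -
    obtain p where p: "p \<in> carrier F" "x = cls p"
      using x by (auto simp: FactRing_def A_RCOSETS_def' cls_def)
    have "scal c * p = p * scal c"
      unfolding scal_def by (induction p rule: poly_mapping_sum_induct)
        (simp_all add: mult_single mult.commute distrib_left distrib_right)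
    then show ?thesis
      using ring_hom_mult[OF cls_hom, of "scal c" p] ring_hom_mult[OF cls_hom, of p "scal c"] p
      by (simp add: free_algebra_closed free_algebra_simps(2))
  qed
  ultimately show "free_algebra_rep Q (\<lambda>c. cls (scal c)) X cls"
    by unfold_locales (auto intro: ring_hom_closed[OF cls_hom] free_algebra_closed cls_hom)
qed

lemma cls_surj:
  assumes "x \<in> carrier Q"
  obtains p where "p \<in> carrier F" "x = cls p"
  using assms by (auto simp: FactRing_def A_RCOSETS_def' cls_def)

lemma cls_relation: 
  assumes "(l, r) \<in> Rel"
  shows "cls l = cls r"
proof -
  have lr: "l \<in> carrier F" "r \<in> carrier F"
    using rel_carrier[OF assms] by auto
  have "l - r \<in> I"
    unfolding I_def using free.genideal_self[OF relators_carrier] assms by blast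
  then have "l \<in> I +>\<^bsub>F\<^esub> r"
    by (auto simp: a_r_coset_def' free_algebra_simps intro!: bexI[of _ "l - r"])
  then show ?thesis
    unfolding cls_def using lr(2) by (rule rel_ideal.a_repr_independence'[symmetric])
qed

text \<open>
  The kernel of \<open>\<kappa>\<close> is an ideal that contains all relators, hence also the ideal
  they generate. So \<open>\<kappa>\<close> is constant on residue classes.
\<close>

lemma universal_property:
  fixes B (structure)
  assumes "free_algebra_rep B sc X \<kappa>" and rel: "\<And>l r. (l, r) \<in> Rel \<Longrightarrow> \<kappa> l = \<kappa> r"
  shows "\<exists>\<theta> \<in> ring_hom Q B. \<forall>p \<in> carrier F. \<theta> (cls p) = \<kappa> p"
proof -
  interpret \<kappa>: free_algebra_rep B sc X \<kappa>
    by (rule assms(1))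
  have "l - r \<in> a_kernel F B \<kappa>" if "(l, r) \<in> Rel" for l r
  proof -
    have lr: "l \<in> carrier F" "r \<in> carrier F"
      using rel_carrier[OF that] by auto
    then have "\<kappa> (l - r) = \<zero>"
      using rel[OF that] \<kappa>.rep_closed[OF lr(2)] by (simp add: \<kappa>.rep_diff \<kappa>.minus_eq \<kappa>.r_neg)
    then show ?thesis
      unfolding a_kernel_def' using free_algebra_closed(2)[OF lr] by blast
  qed
  then have "{l - r |l r. (l, r) \<in> Rel} \<subseteq> a_kernel F B \<kappa>"
    by blast
  then have I: "I \<subseteq> a_kernel F B \<kappa>"
    unfolding I_def by (intro free.genideal_minimal \<kappa>.rep.kernel_is_ideal)
  have img: "\<kappa> ` cls p = {\<kappa> p}" if p: "p \<in> carrier F" for p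
  proof -
    have "\<kappa> x = \<kappa> p" if "x \<in> cls p" for x
    proof -
      obtain i where i: "i \<in> I" "x = i + p"
        using \<open>x \<in> cls p\<close> by (auto simp: cls_def a_r_coset_def' free_algebra_simps)
      have "i \<in> {i \<in> carrier F. \<kappa> i = \<zero>}"
        using I i(1) unfolding a_kernel_def' by (rule subsetD)
      then have "i \<in> carrier F" "\<kappa> i = \<zero>"
        by simp_all
      then show ?thesis
        using p i by simp
    qed
    moreover have "p \<in> cls p"
      unfolding cls_def by (rule rel_ideal.a_rcos_self[OF p])
    ultimately show ?thesis by blast
  qed
  define \<theta> where "\<theta> C = the_elem (\<kappa> ` C)" for C
  have \<theta>: "\<theta> (cls p) = \<kappa> p" if "p \<in> carrier F" for p
    using img[OF that] by (simp add: \<theta>_def)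
  have "\<theta> \<in> ring_hom Q B"
  proof (rule ring_hom_memI)
    fix x y assume "x \<in> carrier Q" "y \<in> carrier Q"
    from this obtain p q where pq: "p \<in> carrier F" "x = cls p" "q \<in> carrier F" "y = cls q"
      by (elim cls_surj)
    then show "\<theta> x \<in> carrier B" "\<theta> (x \<otimes>\<^bsub>Q\<^esub> y) = \<theta> x \<otimes> \<theta> y" "\<theta> (x \<oplus>\<^bsub>Q\<^esub> y) = \<theta> x \<oplus> \<theta> y"
      by (simp_all add: \<theta> free_algebra_closed flip: cls.rep_ops)
  next
    show "\<theta> \<one>\<^bsub>Q\<^esub> = \<one>"
      by (simp add: \<theta> free_algebra_closed flip: cls.rep_ops)
  qed
  with \<theta> show ?thesis
    by blast
qed

text \<open>
  Composed with the residue class map, the endomorphism and the identity become two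
  representations of the free algebra that have the same values on generators.
\<close>

lemma endomorphism_identity:
  assumes h: "h \<in> ring_hom Q Q" and scal: "\<And>c. h (cls (scal c)) = cls (scal c)"
    and gens: "\<And>x. x \<in> X \<Longrightarrow> h (cls (gen x)) = cls (gen x)" and x: "x \<in> carrier Q"
  shows "h x = x"
proof -
  obtain p where p: "p \<in> carrier F" "x = cls p"
    using x by (rule cls_surj)
  define f where "f x = (if x \<in> X then cls (gen x) else \<zero>\<^bsub>Q\<^esub>)" for x
  have f: "f \<in> UNIV \<rightarrow> carrier Q"
    by (auto simp: f_def free_algebra_closed)
  have "free_algebra_rep Q (\<lambda>c. cls (scal c)) X (h \<circ> cls)"
    by (intro free_algebra_rep.intro free_algebra_rep_axioms.intro cls.scalar_ring_axioms
        ring_hom_trans[OF cls_hom h]) (simp add: scal)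
  from free_algebra_rep.rep_eq_eval[OF this f _ p(1)] have "(h \<circ> cls) p = cls.eval f p"
    by (simp add: gens f_def)
  moreover have "cls p = cls.eval f p"
    using p(1) f by (intro cls.rep_eq_eval) (auto simp: f_def)
  ultimately show ?thesis
    using p by simp
qed

lemma presented_algebra_fields:
  "carrier (presented_algebra X Rel) = carrier Q" "mult (presented_algebra X Rel) = mult Q"
  "one (presented_algebra X Rel) = one Q" "add (presented_algebra X Rel) = add Q"
  by (simp_all add: presented_algebra_def quotient_algebra_def ring.defs I_def)

lemma presented_algebra_smult:
  assumes x: "x \<in> carrier Q"
  shows "c \<odot>\<^bsub>presented_algebra X Rel\<^esub> x = cls (scal c) \<otimes>\<^bsub>Q\<^esub> x"
proof -
  obtain p where p: "p \<in> carrier F" "x = cls p"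
    using x by (rule cls_surj)
  then show ?thesis
    using smult_quotient_algebra[OF rel_ideal.ideal_axioms p(1), of c]
    unfolding presented_algebra_def I_def[symmetric] cls_def[symmetric]
    by (simp add: free_algebra_closed)
qed

end

text \<open>
  Mutual inverseness only has to be tested on generators. The conditions on scalars
  turn ring homomorphisms into algebra homomorphisms.
\<close>

lemma presented_algebra_isoI:
  assumes "presentation X R" "presentation Y S"
  defines "A \<equiv> presentation.Q X R" and "B \<equiv> presentation.Q Y S"
    and "a \<equiv> presentation.cls X R" and "b \<equiv> presentation.cls Y S"
  assumes \<theta>: "\<theta> \<in> ring_hom A B" "\<And>c. \<theta> (a (scal c)) = b (scal c)"
    and \<eta>: "\<eta> \<in> ring_hom B A" "\<And>c. \<eta> (b (scal c)) = a (scal c)"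
    and \<eta>\<theta>: "\<And>x. x \<in> X \<Longrightarrow> \<eta> (\<theta> (a (gen x))) = a (gen x)"
    and \<theta>\<eta>: "\<And>y. y \<in> Y \<Longrightarrow> \<theta> (\<eta> (b (gen y))) = b (gen y)"
  shows "presented_algebra X R \<simeq>\<^sub>a\<^sub>l\<^sub>g presented_algebra Y S"
proof -
  interpret A: presentation X R by fact
  interpret B: presentation Y S by fact
  note defs = A_def B_def a_def b_def
  have 1: "\<eta> (\<theta> x) = x" if "x \<in> carrier A" for x
    using A.endomorphism_identity[of "\<eta> \<circ> \<theta>" x] ring_hom_trans[OF \<theta>(1) \<eta>(1)] \<theta>(2) \<eta>(2) \<eta>\<theta> that
    by (simp add: defs)
  have 2: "\<theta> (\<eta> y) = y" if "y \<in> carrier B" for y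
    using B.endomorphism_identity[of "\<theta> \<circ> \<eta>" y] ring_hom_trans[OF \<eta>(1) \<theta>(1)] \<theta>(2) \<eta>(2) \<theta>\<eta> that
    by (simp add: defs)
  have "bij_betw \<theta> (carrier A) (carrier B)"
    using 1 2 ring_hom_closed[OF \<theta>(1)] ring_hom_closed[OF \<eta>(1)]
    by (intro bij_betw_byWitness[where f' = \<eta>]) auto
  then have "\<theta> \<in> ring_iso (presented_algebra X R) (presented_algebra Y S)"
    using \<theta>(1) by (simp add: ring_iso_def ring_hom_def A.presented_algebra_fields
      B.presented_algebra_fields defs)
  moreover have "\<theta> (c \<odot>\<^bsub>presented_algebra X R\<^esub> x) = c \<odot>\<^bsub>presented_algebra Y S\<^esub> \<theta> x"
    if "x \<in> carrier A" for c x
    using that \<theta> ring_hom_closed[OF \<theta>(1)] ring_hom_mult[OF \<theta>(1), of "a (scal c)" x]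
    by (simp add: A.presented_algebra_smult B.presented_algebra_smult defs)
  ultimately show ?thesis
    by (auto simp: is_algebra_iso_def algebra_iso_def A.presented_algebra_fields defs)
qed

section \<open>Ties between arbitrary points\<close>

lemma adjacent_sym: "adjacent a b \<longleftrightarrow> adjacent b a"
  by (auto simp: adjacent_def)

lemma transpose_mem:
  "a \<in> {1..<n} \<Longrightarrow> i \<in> {1..n} \<Longrightarrow> transpose a (Suc a) i \<in> {1..n}"
  by (auto simp: transpose_def)

text \<open>
  An identity \<open>w x = y w\<close> with invertible \<open>w\<close> says that conjugation by \<open>w\<close> maps \<open>x\<close> to \<open>y\<close>. In
  this reading the mixed relations of the bt-algebra describe an action of automorphisms.
\<close>

context ring
begin

definition conjugate :: "'a \<Rightarrow> 'a \<Rightarrow> 'a" where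
  "conjugate w x = w \<otimes> x \<otimes> inv w"

lemma conjugate_closed [simp]:
  "w \<in> Units R \<Longrightarrow> x \<in> carrier R \<Longrightarrow> conjugate w x \<in> carrier R"
  by (simp add: conjugate_def Units_closed)

lemma conjugate_swap:
  "w \<in> Units R \<Longrightarrow> x \<in> carrier R \<Longrightarrow> w \<otimes> x = conjugate w x \<otimes> w"
  by (simp add: conjugate_def Units_closed m_assoc)

lemma conjugate_eqI:
  assumes "w \<in> Units R" "x \<in> carrier R" "y \<in> carrier R" "w \<otimes> x = y \<otimes> w"
  shows "conjugate w x = y"
  using assms by (simp add: conjugate_def Units_closed m_assoc)

lemma conjugate_eq_iff:
  assumes "w \<in> Units R" "x \<in> carrier R" "y \<in> carrier R"
  shows "conjugate w x = conjugate w y \<longleftrightarrow> x = y"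
  using assms conjugate_swap[of w] by (metis Units_l_cancel)

lemma conjugate_mult:
  assumes "w \<in> Units R" "x \<in> carrier R" "y \<in> carrier R"
  shows "conjugate w (x \<otimes> y) = conjugate w x \<otimes> conjugate w y"
proof (rule conjugate_eqI)
  have "w \<otimes> (x \<otimes> y) = conjugate w x \<otimes> (w \<otimes> y)"
    using assms conjugate_swap[of w x] by (simp add: Units_closed flip: m_assoc)
  then show "w \<otimes> (x \<otimes> y) = conjugate w x \<otimes> conjugate w y \<otimes> w"
    using assms conjugate_swap[of w y] by (simp add: Units_closed m_assoc)
qed (use assms in auto)

lemma conjugate_one [simp]: "w \<in> Units R \<Longrightarrow> conjugate w \<one> = \<one>"
  by (intro conjugate_eqI) (auto simp: Units_closed)

lemma conjugate_zero [simp]: "w \<in> Units R \<Longrightarrow> conjugate w \<zero> = \<zero>"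
  by (intro conjugate_eqI) (auto simp: Units_closed)

lemma conjugate_comp:
  assumes "v \<in> Units R" "w \<in> Units R" "x \<in> carrier R"
  shows "conjugate v (conjugate w x) = conjugate (v \<otimes> w) x"
proof (rule sym, rule conjugate_eqI)
  have "v \<otimes> w \<otimes> x = v \<otimes> conjugate w x \<otimes> w"
    using assms conjugate_swap[of w x] by (simp add: Units_closed m_assoc)
  then show "v \<otimes> w \<otimes> x = conjugate v (conjugate w x) \<otimes> (v \<otimes> w)"
    using assms conjugate_swap[of v "conjugate w x"] by (simp add: Units_closed flip: m_assoc)
qed (use assms in auto)

end

text \<open>
  The relations of the bt-algebra in an arbitrary ring. They are needed for two families:
  the generators of the bt-algebra, and elements of the other algebra.
\<close>

locale bt_family = scalar_ring R sc for R (structure) and sc :: "'k::field \<Rightarrow> 'a" +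
  fixes n :: nat and q :: 'k and g e :: "nat \<Rightarrow> 'a"
  assumes q: "q \<noteq> 0" "q \<noteq> 1"
    and g_closed [simp]: "a \<in> {1..<n} \<Longrightarrow> g a \<in> carrier R"
    and e_closed [simp]: "a \<in> {1..<n} \<Longrightarrow> e a \<in> carrier R"
    and g_e: "a \<in> {1..<n} \<Longrightarrow> g a \<otimes> e a = e a \<otimes> g a"
    and braid: "a \<in> {1..<n} \<Longrightarrow> b \<in> {1..<n} \<Longrightarrow> adjacent a b \<Longrightarrow>
      g a \<otimes> g b \<otimes> g a = g b \<otimes> g a \<otimes> g b"
    and g_commute: "a \<in> {1..<n} \<Longrightarrow> b \<in> {1..<n} \<Longrightarrow> distant a b \<Longrightarrow> g a \<otimes> g b = g b \<otimes> g a"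
    and e_g_g: "a \<in> {1..<n} \<Longrightarrow> b \<in> {1..<n} \<Longrightarrow> adjacent a b \<Longrightarrow>
      e a \<otimes> g b \<otimes> g a = g b \<otimes> g a \<otimes> e b"
    and e_e_g: "a \<in> {1..<n} \<Longrightarrow> b \<in> {1..<n} \<Longrightarrow> adjacent a b \<Longrightarrow>
      e a \<otimes> e b \<otimes> g b = e a \<otimes> g b \<otimes> e a"
    and e_g_e: "a \<in> {1..<n} \<Longrightarrow> b \<in> {1..<n} \<Longrightarrow> adjacent a b \<Longrightarrow>
      e a \<otimes> g b \<otimes> e a = g b \<otimes> e a \<otimes> e b"
    and e_commute: "a \<in> {1..<n} \<Longrightarrow> b \<in> {1..<n} \<Longrightarrow> e a \<otimes> e b = e b \<otimes> e a"
    and g_e_commute: "a \<in> {1..<n} \<Longrightarrow> b \<in> {1..<n} \<Longrightarrow> distant a b \<Longrightarrow> g a \<otimes> e b = e b \<otimes> g a"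
    and e_idem: "a \<in> {1..<n} \<Longrightarrow> e a \<otimes> e a = e a"
    and g_square: "a \<in> {1..<n} \<Longrightarrow> g a \<otimes> g a = sc q \<oplus> sc (q - 1) \<otimes> e a \<otimes> g a"
begin

text \<open>
  The inverse is \<open>(1 / q) (g\<^sub>a - (q - 1) e\<^sub>a)\<close>, by the quadratic relation.
\<close>

lemma g_unit [simp]:
  assumes a: "a \<in> {1..<n}"
  shows "g a \<in> Units R"
proof -
  define h where "h = sc (1 / q) \<otimes> (g a \<ominus> sc (q - 1) \<otimes> e a)"
  note cl [simp] = g_closed[OF a] e_closed[OF a]
  have [simp]: "h \<in> carrier R"
    by (simp add: h_def)
  have sq: "g a \<otimes> g a \<ominus> sc (q - 1) \<otimes> e a \<otimes> g a = sc q"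
    unfolding g_square[OF a] by (simp add: minus_eq a_assoc r_neg)
  have "h \<otimes> g a = sc (1 / q) \<otimes> (g a \<otimes> g a \<ominus> sc (q - 1) \<otimes> e a \<otimes> g a)"
    by (simp add: h_def m_assoc minus_eq l_distr l_minus)
  also have "\<dots> = \<one>"
    using q(1) by (simp add: sq flip: sc_mult sc_one)
  finally have 1: "h \<otimes> g a = \<one>" .
  have "g a \<otimes> (sc (q - 1) \<otimes> e a) = sc (q - 1) \<otimes> e a \<otimes> g a"
    using sc_central[of "g a" "q - 1"] g_e[OF a] by (metis cl m_assoc sc_closed)
  then have "g a \<otimes> (g a \<ominus> sc (q - 1) \<otimes> e a) = (g a \<ominus> sc (q - 1) \<otimes> e a) \<otimes> g a"
    by (simp add: minus_eq l_distr r_distr l_minus r_minus)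
  then have "g a \<otimes> h = h \<otimes> g a"
    unfolding h_def using sc_central[of "g a" "1 / q"]
    by (metis cl m_assoc m_closed minus_closed sc_closed)
  with 1 show ?thesis
    unfolding Units_def by force
qed

abbreviation T :: "nat \<Rightarrow> 'a \<Rightarrow> 'a" where
  "T a \<equiv> conjugate (g a)"

lemma T_commute:
  assumes "a \<in> {1..<n}" "b \<in> {1..<n}" "distant a b" "x \<in> carrier R"
  shows "T a (T b x) = T b (T a x)"
  using assms g_commute[of a b] by (simp add: conjugate_comp)

lemma T_braid:
  assumes "a \<in> {1..<n}" "b \<in> {1..<n}" "adjacent a b" "x \<in> carrier R"
  shows "T a (T b (T a x)) = T b (T a (T b x))"
  using assms braid[of a b] by (simp add: conjugate_comp m_assoc)

lemma T_e [simp]: "a \<in> {1..<n} \<Longrightarrow> T a (e a) = e a"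
  by (intro conjugate_eqI) (auto simp: g_e)

lemma T_e_distant: "a \<in> {1..<n} \<Longrightarrow> b \<in> {1..<n} \<Longrightarrow> distant a b \<Longrightarrow> T a (e b) = e b"
  by (intro conjugate_eqI) (auto simp: g_e_commute)

text \<open>
  By the quadratic relation it suffices that \<open>e\<^sub>a\<close> commutes with \<open>e\<^sub>b g\<^sub>b\<close>, and
  \<open>e\<^sub>b g\<^sub>b e\<^sub>a = g\<^sub>b e\<^sub>a e\<^sub>b = e\<^sub>a g\<^sub>b e\<^sub>a = e\<^sub>a e\<^sub>b g\<^sub>b\<close>.
\<close>

lemma T_T_e_adjacent:
  assumes a: "a \<in> {1..<n}" and b: "b \<in> {1..<n}" and ab: "adjacent a b"
  shows "T b (T b (e a)) = e a"
proof -
  note cl [simp] = g_closed[OF a] e_closed[OF a] g_closed[OF b] e_closed[OF b]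
  have "e b \<otimes> g b \<otimes> e a = g b \<otimes> (e b \<otimes> e a)"
    by (simp add: m_assoc flip: g_e[OF b])
  also have "\<dots> = e a \<otimes> (e b \<otimes> g b)"
    using e_e_g[OF a b ab] e_g_e[OF a b ab] by (simp add: m_assoc e_commute[OF b a])
  finally have *: "e b \<otimes> g b \<otimes> e a = e a \<otimes> (e b \<otimes> g b)" .
  have "g b \<otimes> g b \<otimes> e a = sc q \<otimes> e a \<oplus> sc (q - 1) \<otimes> (e b \<otimes> g b \<otimes> e a)"
    by (simp add: g_square[OF b] l_distr m_assoc)
  also have "sc (q - 1) \<otimes> (e b \<otimes> g b \<otimes> e a) = e a \<otimes> (sc (q - 1) \<otimes> e b \<otimes> g b)"
    unfolding * using sc_central[of "e a" "q - 1"] by (metis cl m_assoc m_closed sc_closed)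
  also have "sc q \<otimes> e a \<oplus> e a \<otimes> (sc (q - 1) \<otimes> e b \<otimes> g b) = e a \<otimes> (g b \<otimes> g b)"
    by (simp add: g_square[OF b] r_distr sc_central)
  finally have "conjugate (g b \<otimes> g b) (e a) = e a"
    using a b by (intro conjugate_eqI) auto
  then show ?thesis
    using a b by (simp add: conjugate_comp)
qed

text \<open>
  The relation \<open>e\<^sub>a g\<^sub>b g\<^sub>a = g\<^sub>b g\<^sub>a e\<^sub>b\<close> says \<open>T\<^sub>b (T\<^sub>a e\<^sub>b) = e\<^sub>a\<close>,
  and \<open>e\<^sub>a\<close> is also equal to \<open>T\<^sub>b (T\<^sub>b e\<^sub>a)\<close>.
  For \<open>b = a + 1\<close> the common value of the two sides is the tie between \<open>a\<close> and \<open>a + 2\<close>.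
\<close>

lemma T_e_adjacent:
  assumes a: "a \<in> {1..<n}" and b: "b \<in> {1..<n}" and ab: "adjacent a b"
  shows "T b (e a) = T a (e b)"
proof -
  have "conjugate (g b \<otimes> g a) (e b) = e a"
    using a b e_g_g[OF a b ab] by (intro conjugate_eqI) (auto simp: m_assoc)
  then have "T b (T a (e b)) = T b (T b (e a))"
    using a b T_T_e_adjacent[OF a b ab] by (simp add: conjugate_comp)
  then show ?thesis
    using a b by (simp add: conjugate_eq_iff)
qed

text \<open>
  \<open>T\<^sub>a\<close> fixes \<open>e\<^sub>a\<close> and, by two of the mixed relations, also the product \<open>e\<^sub>b e\<^sub>a\<close>.
\<close>

lemma e_T_e_adjacent:
  assumes a: "a \<in> {1..<n}" and b: "b \<in> {1..<n}" and ab: "adjacent a b"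
  shows "e a \<otimes> T a (e b) = e a \<otimes> e b"
proof -
  have ba: "adjacent b a"
    using ab by (simp add: adjacent_sym)
  have "T a (e b \<otimes> e a) = e b \<otimes> e a"
    using a b e_e_g[OF b a ba] e_g_e[OF b a ba] by (intro conjugate_eqI) (auto simp: m_assoc)
  then show ?thesis
    using a b by (simp add: conjugate_mult e_commute[OF b a])
qed

text \<open>
  The tie between \<open>i\<close> and \<open>i + d + 1\<close>: the tie \<open>e\<close> of two neighbours at the right end, whose
  left point is moved down to \<open>i\<close> step by step. The next lemmas determine how each
  \<open>T\<^sub>a\<close> acts on it, according to the position of \<open>a\<close>.
\<close>

primrec tie_span :: "nat \<Rightarrow> nat \<Rightarrow> 'a" where
  "tie_span 0 i = e i"
| "tie_span (Suc d) i = T i (tie_span d (Suc i))"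

lemma tie_span_closed [simp]: "1 \<le> i \<Longrightarrow> i + d < n \<Longrightarrow> tie_span d i \<in> carrier R"
  by (induction d arbitrary: i) auto

lemma tie_span_outside:
  assumes "1 \<le> i" "i + d < n" "a \<in> {1..<n}" "Suc a < i \<or> i + d + 1 < a"
  shows "T a (tie_span d i) = tie_span d i"
  using assms
proof (induction d arbitrary: i)
  case 0
  then show ?case by (auto simp: T_e_distant distant_def)
next
  case (Suc d)
  then have "T a (T i (tie_span d (Suc i))) = T i (T a (tie_span d (Suc i)))"
    by (intro T_commute) (auto simp: distant_def)
  moreover have "T a (tie_span d (Suc i)) = tie_span d (Suc i)"
    using Suc.prems by (intro Suc.IH) auto
  ultimately show ?case by simp
qed

text \<open>
  Moving the right end up gives the same element as moving the left end down. This
  frees the later arguments from the asymmetry of the definition.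
\<close>

lemma tie_span_right:
  assumes "1 \<le> i" "i + d + 1 < n"
  shows "T (i + d + 1) (tie_span d i) = tie_span (Suc d) i"
  using assms
proof (induction d arbitrary: i)
  case 0
  then show ?case using T_e_adjacent[of i "Suc i"] by (simp add: adjacent_def)
next
  case (Suc d)
  then have "T (i + Suc d + 1) (T i (tie_span d (Suc i))) = T i (T (i + Suc d + 1) (tie_span d (Suc i)))"
    by (intro T_commute) (auto simp: distant_def)
  also have "T (i + Suc d + 1) (tie_span d (Suc i)) = tie_span (Suc d) (Suc i)"
    using Suc.IH[of "Suc i"] Suc.prems by simp
  finally show ?case by simp
qed

text \<open>
  By the symmetric description the right end can be moved away by automorphisms
  that commute with \<open>T\<^sub>i\<close>, until only the case of neighbours is left.
\<close>

lemma tie_span_left_twice: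
  assumes "1 \<le> i" "i + d + 1 < n"
  shows "T i (T i (tie_span d (Suc i))) = tie_span d (Suc i)"
  using assms
proof (induction d)
  case 0
  then show ?case using T_T_e_adjacent[of "Suc i" i] by (simp add: adjacent_def)
next
  case (Suc d)
  let ?j = "Suc i + d + 1"
  have j: "tie_span (Suc d) (Suc i) = T ?j (tie_span d (Suc i))"
    using Suc.prems tie_span_right[of "Suc i" d] by simp
  have "T i (T ?j x) = T ?j (T i x)" if "x \<in> carrier R" for x
    using Suc.prems that by (intro T_commute) (auto simp: distant_def)
  then show ?case
    unfolding j using Suc by simp
qed

lemma tie_span_right_twice:
  assumes "1 \<le> i" "i + d + 1 < n"
  shows "T (i + d + 1) (T (i + d + 1) (tie_span d i)) = tie_span d i"
  using assms
proof (induction d arbitrary: i)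
  case 0
  then show ?case using T_T_e_adjacent[of i "Suc i"] by (simp add: adjacent_def)
next
  case (Suc d)
  let ?j = "Suc i + d + 1"
  have "T ?j (T i x) = T i (T ?j x)" if "x \<in> carrier R" for x
    using Suc.prems that by (intro T_commute) (auto simp: distant_def)
  then show ?case
    using Suc.IH[of "Suc i"] Suc.prems by simp
qed

text \<open>
  Here the braid relation enters:
  \<open>T\<^sub>a T\<^sub>i T\<^sub>a = T\<^sub>i T\<^sub>a T\<^sub>i\<close> with \<open>a = i + 1\<close> moves \<open>T\<^sub>i\<close> next to a tie
  that starts at \<open>a + 1\<close>, which it fixes.
\<close>

lemma tie_span_inside:
  assumes "1 \<le> i" "i + d < n" "i < a" "a < i + d"
  shows "T a (tie_span d i) = tie_span d i"
  using assms
proof (induction d arbitrary: i)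
  case (Suc d)
  show ?case
  proof (cases "a = Suc i")
    case True
    then obtain d' where d': "d = Suc d'"
      using Suc.prems by (cases d) auto
    have "T a (T i (T a (tie_span d' (Suc a)))) = T i (T a (T i (tie_span d' (Suc a))))"
      using Suc.prems True d' by (intro T_braid) (auto simp: adjacent_def)
    also have "T i (tie_span d' (Suc a)) = tie_span d' (Suc a)"
      using Suc.prems True d' by (intro tie_span_outside) auto
    finally show ?thesis
      using True d' by simp
  next
    case False
    then have "T a (T i (tie_span d (Suc i))) = T i (T a (tie_span d (Suc i)))"
      using Suc.prems by (intro T_commute) (auto simp: distant_def)
    then show ?thesis
      using Suc.IH[of "Suc i"] Suc.prems False by simp
  qed
qed simp

text \<open>
  The value \<open>\<one>\<close> on the diagonal expresses that a point always lies in its own block.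
  With it the lemmas below hold for all pairs of points.
\<close>

definition tie :: "nat \<Rightarrow> nat \<Rightarrow> 'a" where
  "tie i j = (if i = j then \<one> else tie_span (max i j - min i j - 1) (min i j))"

lemma tie_sym: "tie i j = tie j i"
  by (simp add: tie_def max.commute min.commute)

lemma tie_refl [simp]: "tie i i = \<one>"
  by (simp add: tie_def)

lemma tie_closed [simp]: "i \<in> {1..n} \<Longrightarrow> j \<in> {1..n} \<Longrightarrow> tie i j \<in> carrier R"
  by (auto simp: tie_def)

lemma tie_Suc: "tie a (Suc a) = e a"
  by (simp add: tie_def)

text \<open>
  The relations give no action of the symmetric group on the algebra, since \<open>T\<^sub>a\<^sup>2\<close> is in
  general not the identity. They do give one on the ties, which is how set partitions
  enter.
\<close>

lemma T_tie:
  assumes a: "a \<in> {1..<n}" and i: "i \<in> {1..n}" and j: "j \<in> {1..n}"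
  shows "T a (tie i j) = tie (transpose a (Suc a) i) (transpose a (Suc a) j)"
proof -
  have less: "T a (tie i j) = tie (transpose a (Suc a) i) (transpose a (Suc a) j)"
    if ij: "i < j" "1 \<le> i" "j \<le> n" for i j
  proof -
    define d where "d = j - i - 1"
    have d: "j = i + d + 1"
      using ij(1) by (simp add: d_def)
    have t: "tie i j = tie_span d i"
      using d by (simp add: tie_def)
    consider "Suc a < i" | "Suc a = i" | "a = i" "d = 0" | "a = i" "d \<noteq> 0"
      | "i < a" "a < i + d" | "a = i + d" "d \<noteq> 0" | "a = j" | "a > j"
      using d by linarith
    then show ?thesis
    proof cases
      case 1
      then have "T a (tie_span d i) = tie_span d i"
        using a ij d by (intro tie_span_outside) auto
      then show ?thesis
        using 1 ij by (simp add: t)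
    next
      case 2
      then have "tie a j = tie_span (Suc d) a"
        using d by (simp add: tie_def)
      then show ?thesis
        using 2 ij d t by auto
    next
      case 3
      then show ?thesis
        using a d by (simp add: tie_def)
    next
      case 4
      then obtain d' where d': "d = Suc d'"
        using not0_implies_Suc by blast
      have "T a (tie_span d i) = tie_span d' (Suc i)"
        using 4 d' d ij tie_span_left_twice[of i d'] by simp
      moreover have "tie (Suc i) j = tie_span d' (Suc i)"
        using d d' by (simp add: tie_def)
      ultimately show ?thesis
        using 4 d t by simp
    next
      case 5
      then have "T a (tie_span d i) = tie_span d i"
        using ij d by (intro tie_span_inside) auto
      then show ?thesis
        using 5 d t by simp
    next
      case 6
      then obtain d' where d': "d = Suc d'"
        using not0_implies_Suc by blast
      have "T a (T a (tie_span d' i)) = tie_span d' i" "T a (tie_span d' i) = tie_span d i"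
        using 6 d' d ij tie_span_right_twice[of i d'] tie_span_right[of i d'] by simp_all
      then have "T a (tie_span d i) = tie_span d' i"
        by simp
      moreover have "tie i a = tie_span d' i"
        using 6 d d' by (simp add: tie_def)
      ultimately show ?thesis
        using 6 d t by simp
    next
      case 7
      then have "T a (tie_span d i) = tie_span (Suc d) i"
        using ij a d tie_span_right[of i d] by simp
      moreover have "tie i (Suc j) = tie_span (Suc d) i"
        using d by (simp add: tie_def)
      ultimately show ?thesis
        using 7 ij t by simp
    next
      case 8
      then have "T a (tie_span d i) = tie_span d i"
        using a ij d by (intro tie_span_outside) auto
      then show ?thesis
        using 8 ij by (simp add: t)
    qed
  qed
  consider "i = j" | "i < j" | "j < i"
    by linarith
  then show ?thesis
  proof cases
    case 1
    then show ?thesis using a by simp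
  next
    case 2
    then show ?thesis using less i j by simp
  next
    case 3
    then show ?thesis using less[of j i] i j by (simp add: tie_sym)
  qed
qed

lemma T_tie_shift:
  assumes "1 \<le> i" "Suc i < j" "j \<le> n"
  shows "T i (tie (Suc i) j) = tie i j"
  using T_tie[of i "Suc i" j] assms by simp

text \<open>
  Every tie is a conjugate of some \<open>e\<^sub>a\<close>. The same descent, from \<open>i\<close> to \<open>j - 1\<close>, serves
  for \<open>tie_trans\<close> and \<open>tie_commute\<close>.
\<close>

lemma tie_idem:
  assumes i: "i \<in> {1..n}" and j: "j \<in> {1..n}"
  shows "tie i j \<otimes> tie i j = tie i j"
proof -
  have less: "tie i j \<otimes> tie i j = tie i j" if ij: "i < j" "1 \<le> i" "j \<le> n" for i j
  proof -
    have "i \<le> j - 1"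
      using ij by simp
    then show ?thesis
      using ij(2)
    proof (induction i rule: inc_induct)
      case base
      then show ?case
        using ij tie_Suc[of "j - 1"] e_idem[of "j - 1"] by simp
    next
      case (step i)
      then have "T i (tie (Suc i) j) \<otimes> T i (tie (Suc i) j) = T i (tie (Suc i) j)"
        using ij by (simp flip: conjugate_mult)
      then show ?case
        using step ij by (simp add: T_tie_shift)
    qed
  qed
  show ?thesis
    using less[of i j] less[of j i] i j by (cases i j rule: linorder_cases) (auto simp: tie_sym)
qed

text \<open>
  For \<open>k\<close> in \<open>{a, a + 1}\<close> this is idempotency of \<open>e\<^sub>a\<close>, and for the neighbours of that pair it is
  \<open>e_T_e_adjacent\<close>. From there \<open>k\<close> is moved away by conjugation with elements \<open>g\<^sub>b\<close>, where \<open>b\<close> is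
  distant from \<open>a\<close>, which fixes \<open>e\<^sub>a\<close>.
\<close>

lemma e_tie_slide:
  assumes a: "a \<in> {1..<n}" and k: "k \<in> {1..n}"
  shows "e a \<otimes> tie (Suc a) k = e a \<otimes> tie a k"
proof -
  consider "k = a" | "k = Suc a" | "Suc (Suc a) \<le> k" | "k \<le> a - 1" "a \<noteq> 1"
    using k by force
  then show ?thesis
  proof cases
    case 1
    then show ?thesis
      using a by (simp add: tie_sym[of "Suc a"] tie_Suc e_idem)
  next
    case 2
    then show ?thesis
      using a by (simp add: tie_Suc e_idem)
  next
    case 3
    then show ?thesis
      using k
    proof (induction k rule: dec_induct)
      case base
      then have "tie a (Suc (Suc a)) = T a (e (Suc a))"
        using T_tie_shift[of a "Suc (Suc a)"] a by (simp add: tie_Suc)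
      then show ?case
        using a base e_T_e_adjacent[of a "Suc a"] by (simp add: tie_Suc adjacent_def)
    next
      case (step k)
      then have "T k (e a) \<otimes> T k (tie (Suc a) k) = T k (e a) \<otimes> T k (tie a k)"
        using a by (simp flip: conjugate_mult)
      moreover have "T k (e a) = e a"
        using a step by (intro T_e_distant) (auto simp: distant_def)
      ultimately show ?case
        using a step by (simp add: T_tie)
    qed
  next
    case 4
    then obtain b where b: "a = Suc b" "1 \<le> b"
      using a by (cases a) auto
    have "k \<le> b" "1 \<le> k"
      using k 4 b by auto
    then show ?thesis
    proof (induction k rule: inc_induct)
      case base
      have "tie b (Suc a) = T a (tie b a)"
        using T_tie[of a b a] a b by simp
      then show ?case
        using a b e_T_e_adjacent[of a b] tie_Suc[of b]
        by (simp add: tie_sym[of _ b] adjacent_def)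
    next
      case (step k)
      then have "T k (e a) \<otimes> T k (tie (Suc a) (Suc k)) = T k (e a) \<otimes> T k (tie a (Suc k))"
        using a b by (simp flip: conjugate_mult)
      moreover have "T k (e a) = e a"
        using a step b by (intro T_e_distant) (auto simp: distant_def)
      ultimately show ?case
        using a step b by (simp add: T_tie)
    qed
  qed
qed

text \<open>
  This is transitivity of lying in the same block: in the presence of \<open>tie i j\<close> the points
  \<open>i\<close> and \<open>j\<close> are interchangeable.
\<close>

lemma tie_trans:
  assumes i: "i \<in> {1..n}" and j: "j \<in> {1..n}" and k: "k \<in> {1..n}"
  shows "tie i j \<otimes> tie j k = tie i j \<otimes> tie i k"
proof -
  have less: "tie i j \<otimes> tie j k = tie i j \<otimes> tie i k"
    if ij: "i < j" "1 \<le> i" "j \<le> n" and k: "k \<in> {1..n}" for i j k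
  proof -
    have "i \<le> j - 1"
      using ij by simp
    then show ?thesis
      using ij(2) k
    proof (induction i arbitrary: k rule: inc_induct)
      case base
      then show ?case
        using ij tie_Suc[of "j - 1"] e_tie_slide[of "j - 1" k] by simp
    next
      case (step i)
      have i: "i \<in> {1..<n}" "Suc i < j"
        using step ij by auto
      let ?k = "transpose i (Suc i) k"
      have k': "?k \<in> {1..n}"
        using i step by (intro transpose_mem) auto
      then have "T i (tie (Suc i) j \<otimes> tie j ?k) = T i (tie (Suc i) j \<otimes> tie (Suc i) ?k)"
        using step by simp
      then show ?case
        using i ij k' by (simp add: conjugate_mult T_tie)
    qed
  qed
  show ?thesis
    using less[of i j k] less[of j i k] assms
    by (cases i j rule: linorder_cases) (auto simp: tie_sym[of i j])
qed

lemma e_tie_transpose: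
  assumes a: "a \<in> {1..<n}" and k: "k \<in> {1..n}" and l: "l \<in> {1..n}"
  shows "e a \<otimes> tie (transpose a (Suc a) k) (transpose a (Suc a) l) = e a \<otimes> tie k l"
proof -
  have *: "e a \<otimes> tie (transpose a (Suc a) i) j = e a \<otimes> tie i j" if "j \<in> {1..n}" for i j
    using e_tie_slide[OF a that] by (auto simp: transpose_def)
  show ?thesis
    using *[OF transpose_mem[OF a l], of k] *[OF k, of l] by (simp add: tie_sym)
qed

text \<open>
  As \<open>T\<^sub>a\<^sup>2\<close> fixes the tie \<open>t\<close>, the square \<open>g\<^sub>a\<^sup>2 = q + (q - 1) e\<^sub>a g\<^sub>a\<close> commutes with \<open>t\<close>.
  Since \<open>q \<noteq> 1\<close>, also \<open>e\<^sub>a g\<^sub>a\<close> commutes with \<open>t\<close>. Moving \<open>g\<^sub>a\<close> to the right and cancelling it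
  leaves \<open>e\<^sub>a (T\<^sub>a t) = t e\<^sub>a\<close>, and \<open>e\<^sub>a\<close> does not distinguish \<open>T\<^sub>a t\<close> from \<open>t\<close>.
\<close>

lemma e_tie_commute:
  assumes a: "a \<in> {1..<n}" and k: "k \<in> {1..n}" and l: "l \<in> {1..n}"
  shows "e a \<otimes> tie k l = tie k l \<otimes> e a"
proof -
  note cl [simp] = g_closed[OF a] e_closed[OF a] tie_closed[OF k l]
  let ?t = "tie k l" and ?u = "T a (tie k l)"
  have u: "?u = tie (transpose a (Suc a) k) (transpose a (Suc a) l)"
    using T_tie[OF a k l] .
  have [simp]: "?u \<in> carrier R"
    using a by simp
  have "T a ?u = ?t"
    unfolding u using T_tie[OF a transpose_mem[OF a k] transpose_mem[OF a l]] by simp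
  then have "conjugate (g a \<otimes> g a) ?t = ?t"
    using a by (simp add: conjugate_comp)
  then have "(g a \<otimes> g a) \<otimes> ?t = ?t \<otimes> (g a \<otimes> g a)"
    using conjugate_swap[of "g a \<otimes> g a" ?t] a by simp
  moreover have "(g a \<otimes> g a) \<otimes> ?t = sc q \<otimes> ?t \<oplus> sc (q - 1) \<otimes> (e a \<otimes> g a \<otimes> ?t)"
    by (simp add: g_square[OF a] l_distr m_assoc)
  moreover have "?t \<otimes> (g a \<otimes> g a) = sc q \<otimes> ?t \<oplus> sc (q - 1) \<otimes> (?t \<otimes> e a \<otimes> g a)"
  proof -
    have "?t \<otimes> (sc (q - 1) \<otimes> e a \<otimes> g a) = sc (q - 1) \<otimes> (?t \<otimes> e a \<otimes> g a)"
      using sc_central[of ?t "q - 1"] by (metis cl m_assoc m_closed sc_closed)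
    then show ?thesis
      by (simp add: g_square[OF a] r_distr sc_central)
  qed
  (* The summand q cancels; then the factor q - 1 is invertible. *)
  ultimately have "sc (q - 1) \<otimes> (e a \<otimes> g a \<otimes> ?t) = sc (q - 1) \<otimes> (?t \<otimes> e a \<otimes> g a)"
    by simp
  then have "sc (1 / (q - 1)) \<otimes> (sc (q - 1) \<otimes> (e a \<otimes> g a \<otimes> ?t)) =
      sc (1 / (q - 1)) \<otimes> (sc (q - 1) \<otimes> (?t \<otimes> e a \<otimes> g a))"
    by simp
  moreover have "sc (1 / (q - 1)) \<otimes> (sc (q - 1) \<otimes> x) = x" if "x \<in> carrier R" for x
  proof -
    have "sc (1 / (q - 1)) \<otimes> (sc (q - 1) \<otimes> x) = sc (1 / (q - 1) * (q - 1)) \<otimes> x"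
      using that by (simp only: sc_mult sc_closed m_assoc)
    then show ?thesis
      using that q(2) by (simp add: sc_one)
  qed
  ultimately have "e a \<otimes> (g a \<otimes> ?t) = ?t \<otimes> e a \<otimes> g a"
    by (simp add: m_assoc)
  then have "(e a \<otimes> ?u) \<otimes> g a = (?t \<otimes> e a) \<otimes> g a"
    using conjugate_swap[of "g a" ?t] a by (simp add: m_assoc)
  then have "(e a \<otimes> ?u) \<otimes> g a \<otimes> inv g a = (?t \<otimes> e a) \<otimes> g a \<otimes> inv g a"
    by simp
  then have "e a \<otimes> ?u = ?t \<otimes> e a"
    using a by (simp add: m_assoc)
  then show ?thesis
    unfolding u e_tie_transpose[OF a k l] .
qed

lemma tie_commute:
  assumes i: "i \<in> {1..n}" and j: "j \<in> {1..n}" and k: "k \<in> {1..n}" and l: "l \<in> {1..n}"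
  shows "tie i j \<otimes> tie k l = tie k l \<otimes> tie i j"
proof -
  have less: "tie i j \<otimes> tie k l = tie k l \<otimes> tie i j"
    if ij: "i < j" "1 \<le> i" "j \<le> n" and k: "k \<in> {1..n}" and l: "l \<in> {1..n}" for i j k l
  proof -
    have "i \<le> j - 1"
      using ij by simp
    then show ?thesis
      using ij(2) k l
    proof (induction i arbitrary: k l rule: inc_induct)
      case base
      then show ?case
        using ij tie_Suc[of "j - 1"] e_tie_commute[of "j - 1" k l] by simp
    next
      case (step i)
      have i: "i \<in> {1..<n}" "Suc i < j"
        using step ij by auto
      let ?k = "transpose i (Suc i) k" and ?l = "transpose i (Suc i) l"
      have kl: "?k \<in> {1..n}" "?l \<in> {1..n}"
        using transpose_mem[OF i(1) step.prems(2)] transpose_mem[OF i(1) step.prems(3)] .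
      then have "T i (tie (Suc i) j \<otimes> tie ?k ?l) = T i (tie ?k ?l \<otimes> tie (Suc i) j)"
        using step by simp
      then show ?case
        using i ij kl by (simp add: conjugate_mult T_tie)
    qed
  qed
  show ?thesis
    using less[of i j k l] less[of j i k l] assms
    by (cases i j rule: linorder_cases) (auto simp: tie_sym[of i j])
qed

end

section \<open>Boolean atoms of commuting idempotents\<close>

context ring
begin

text \<open>
  For commuting idempotents \<open>u x\<close> these are the atoms of the Boolean algebra that they
  generate. The factors are taken in the order of a list, as the ring is
  not commutative.
\<close>

primrec atom :: "('i \<Rightarrow> 'a) \<Rightarrow> 'i list \<Rightarrow> 'i set \<Rightarrow> 'a" where
  "atom u [] S = \<one>"
| "atom u (x # xs) S = (if x \<in> S then u x else \<one> \<ominus> u x) \<otimes> atom u xs S"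

lemma atom_closed [simp]: "u \<in> set xs \<rightarrow> carrier R \<Longrightarrow> atom u xs S \<in> carrier R"
  by (induction xs) auto

lemma atom_cong: "S \<inter> set xs = S' \<inter> set xs \<Longrightarrow> atom u xs S = atom u xs S'"
proof (induction xs)
  case (Cons x xs)
  have "x \<in> S \<longleftrightarrow> x \<in> S'" "S \<inter> set xs = S' \<inter> set xs"
    using Cons.prems by auto
  then show ?case
    using Cons.IH by simp
qed simp

text \<open>
  Expand the product of all \<open>u x + (1 - u x)\<close>.
\<close>

lemma atom_sum:
  assumes "distinct xs" "u \<in> set xs \<rightarrow> carrier R"
  shows "(\<Oplus>S\<in>Pow (set xs). atom u xs S) = \<one>"
  using assms
proof (induction xs)
  case Nil
  show ?case by simp
next
  case (Cons x xs)
  have x: "x \<notin> set xs" "u x \<in> carrier R" and u: "u \<in> set xs \<rightarrow> carrier R"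
    using Cons.prems by auto
  have [simp]: "atom u xs S \<in> carrier R" for S
    using u by simp
  have sum1: "(\<Oplus>S\<in>Pow (set xs). atom u xs S) = \<one>"
    using Cons by simp
  have inj: "inj_on (insert x) (Pow (set xs))"
    using x(1) by (auto simp: inj_on_def)
  have disj: "Pow (set xs) \<inter> insert x ` Pow (set xs) = {}"
    using x(1) by auto
  have "(\<Oplus>S\<in>Pow (set (x # xs)). atom u (x # xs) S) =
      (\<Oplus>S\<in>Pow (set xs). atom u (x # xs) S) \<oplus> (\<Oplus>S\<in>insert x ` Pow (set xs). atom u (x # xs) S)"
    using x by (simp add: Pow_insert finsum_Un_disjoint[OF _ _ disj] Pi_iff)
  also have "(\<Oplus>S\<in>insert x ` Pow (set xs). atom u (x # xs) S) =
      (\<Oplus>S\<in>Pow (set xs). atom u (x # xs) (insert x S))"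
    using x inj by (intro finsum_reindex) auto
  also have "\<dots> = (\<Oplus>S\<in>Pow (set xs). u x \<otimes> atom u xs S)"
    using x by (intro finsum_cong') (auto intro!: arg_cong[of _ _ "\<lambda>y. u x \<otimes> y"] atom_cong)
  also have "\<dots> = u x"
    using x by (simp add: sum1 Pi_iff flip: finsum_rdistr)
  also have "(\<Oplus>S\<in>Pow (set xs). atom u (x # xs) S) = (\<Oplus>S\<in>Pow (set xs). (\<one> \<ominus> u x) \<otimes> atom u xs S)"
    using x by (intro finsum_cong') auto
  also have "\<dots> = \<one> \<ominus> u x"
    using x by (simp add: sum1 Pi_iff flip: finsum_rdistr)
  also have "(\<one> \<ominus> u x) \<oplus> u x = \<one>"
    using x by (simp add: minus_eq a_assoc l_neg)
  finally show ?case .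
qed

lemma commute_atom:
  assumes u: "u \<in> set xs \<rightarrow> carrier R" and y: "y \<in> carrier R"
    and "\<And>x. x \<in> set xs \<Longrightarrow> y \<otimes> u x = u x \<otimes> y"
  shows "y \<otimes> atom u xs S = atom u xs S \<otimes> y"
  using assms
proof (induction xs)
  case (Cons x xs)
  have [simp]: "u x \<in> carrier R" "atom u xs S \<in> carrier R" "y \<in> carrier R"
    using Cons.prems by auto
  have IH: "y \<otimes> atom u xs S = atom u xs S \<otimes> y"
    using Cons by simp
  let ?v = "if x \<in> S then u x else \<one> \<ominus> u x"
  have "y \<otimes> ?v = ?v \<otimes> y"
    using Cons.prems(3)[of x] by (simp add: minus_eq l_distr r_distr l_minus r_minus)
  then have "y \<otimes> (?v \<otimes> atom u xs S) = ?v \<otimes> (y \<otimes> atom u xs S)"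
    by (simp flip: m_assoc)
  then show ?case
    unfolding IH by (simp add: m_assoc)
qed simp

lemma atom_absorb:
  assumes u: "u \<in> set xs \<rightarrow> carrier R" and x: "x \<in> set xs"
    and idem: "u x \<otimes> u x = u x"
    and comm: "\<And>y. y \<in> set xs \<Longrightarrow> u x \<otimes> u y = u y \<otimes> u x"
  shows "u x \<otimes> atom u xs S = (if x \<in> S then atom u xs S else \<zero>)"
  using assms
proof (induction xs)
  case Nil
  from Nil(2) show ?case by simp
next
  case (Cons y xs)
  have [simp]: "u x \<in> carrier R" "u y \<in> carrier R" "atom u xs S \<in> carrier R"
    using Cons.prems(1,2) by auto
  let ?v = "if y \<in> S then u y else \<one> \<ominus> u y"
  have v [simp]: "?v \<in> carrier R"
    by simp
  show ?case
  proof (cases "x = y")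
    case True
    have "u x \<otimes> ?v = (if x \<in> S then ?v else \<zero>)"
      using Cons.prems(3) True by (simp add: minus_eq r_distr r_minus r_neg)
    then have "u x \<otimes> (?v \<otimes> atom u xs S) = (if x \<in> S then ?v else \<zero>) \<otimes> atom u xs S"
      by (simp only: v \<open>u x \<in> carrier R\<close> \<open>atom u xs S \<in> carrier R\<close> flip: m_assoc)
    then show ?thesis
      by auto
  next
    case False
    have IH: "u x \<otimes> atom u xs S = (if x \<in> S then atom u xs S else \<zero>)"
      using Cons.prems(1,2) False by (intro Cons.IH idem Cons.prems(4)) auto
    have "u x \<otimes> ?v = ?v \<otimes> u x"
      using Cons.prems(4)[of y] by (simp add: minus_eq l_distr r_distr l_minus r_minus)
    then have "u x \<otimes> (?v \<otimes> atom u xs S) = ?v \<otimes> (u x \<otimes> atom u xs S)"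
      by (simp only: v \<open>u x \<in> carrier R\<close> \<open>atom u xs S \<in> carrier R\<close> flip: m_assoc)
    then show ?thesis
      unfolding IH by auto
  qed
qed

text \<open>
  An element on which every \<open>u x\<close> acts as the scalar prescribed by \<open>S\<close> is fixed by the atom
  of \<open>S\<close>. With this, idempotents can be compared with an atom without rearranging its factors.
\<close>

lemma atom_fixes:
  assumes u: "u \<in> set xs \<rightarrow> carrier R" and y: "y \<in> carrier R"
    and "\<And>x. x \<in> set xs \<Longrightarrow> u x \<otimes> y = (if x \<in> S then y else \<zero>)"
  shows "atom u xs S \<otimes> y = y"
  using assms
proof (induction xs)
  case (Cons x xs)
  have [simp]: "u x \<in> carrier R" "atom u xs S \<in> carrier R" "y \<in> carrier R"
    using Cons.prems by auto
  have "atom u xs S \<otimes> y = y"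
    using Cons by simp
  then show ?case
    using Cons.prems(3)[of x] by (simp add: m_assoc minus_eq l_distr l_minus)
qed simp

end

section \<open>Set partitions as equivalence relations\<close>

lemma same_block_sigma_act:
  "same_block (sigma_act a A) i j \<longleftrightarrow>
     same_block A (transpose a (Suc a) i) (transpose a (Suc a) j)"
proof -
  have "i \<in> transpose a (Suc a) ` S \<longleftrightarrow> transpose a (Suc a) i \<in> S" for i S
    by (metis (no_types, lifting) image_iff transpose_involutory)
  then show ?thesis
    by (simp add: same_block_def sigma_act_def)
qed

lemma sigma_act_twice: "sigma_act a (sigma_act a A) = A"
  by (simp add: sigma_act_def image_image)

lemma finite_set_par: "finite (set_par n)"
  unfolding set_par_def by (rule finitely_many_partition_on) simp

lemma same_block_mem: "A \<in> set_par n \<Longrightarrow> same_block A i j \<Longrightarrow> i \<in> {1..n} \<and> j \<in> {1..n}"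
  unfolding set_par_def same_block_def partition_on_def by blast

lemma same_block_refl: "A \<in> set_par n \<Longrightarrow> i \<in> {1..n} \<Longrightarrow> same_block A i i"
  unfolding set_par_def same_block_def partition_on_def by blast

lemma same_block_sym: "same_block A i j \<longleftrightarrow> same_block A j i"
  unfolding same_block_def by blast

lemma same_block_trans:
  assumes "A \<in> set_par n" "same_block A i j"
  shows "same_block A j k \<longleftrightarrow> same_block A i k"
proof -
  have "S = S'" if "S \<in> A" "S' \<in> A" "x \<in> S" "x \<in> S'" for S S' x
    using assms(1) that unfolding set_par_def partition_on_def disjoint_def by blast
  with assms(2) show ?thesis
    unfolding same_block_def by metis
qed

definition block_rel :: "nat set set \<Rightarrow> (nat \<times> nat) set" where
  "block_rel A = {(i, j). same_block A i j}"

lemma quotient_block_rel: "A \<in> set_par n \<Longrightarrow> {1..n} // block_rel A = A"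
  using partition_on_eq_quotient[of "{1..n}" A]
  by (simp add: set_par_def block_rel_def same_block_def)

lemma block_rel_quotient:
  assumes "equiv {1..n} S"
  shows "{1..n} // S \<in> set_par n" and "block_rel ({1..n} // S) = S"
proof -
  show "{1..n} // S \<in> set_par n"
    using partition_on_quotient[OF assms] by (simp add: set_par_def)
  show "block_rel ({1..n} // S) = S"
  proof (intro equalityI subrelI)
    fix i j assume "(i, j) \<in> block_rel ({1..n} // S)"
    then obtain B where "B \<in> {1..n} // S" "i \<in> B" "j \<in> B"
      by (auto simp: block_rel_def same_block_def)
    then show "(i, j) \<in> S"
      using assms in_quotient_imp_in_rel by fastforce
  next
    fix i j assume ij: "(i, j) \<in> S"
    then have "i \<in> {1..n}" "i \<in> S `` {i}" "j \<in> S `` {i}"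
      using assms by (auto simp: equiv_def refl_on_def)
    then show "(i, j) \<in> block_rel ({1..n} // S)"
      by (auto simp: block_rel_def same_block_def intro!: bexI[of _ "S `` {i}"] quotientI)
  qed
qed

section \<open>From ties to orthogonal idempotents\<close>

locale idem_family = scalar_ring R sc for R (structure) and sc :: "'k::field \<Rightarrow> 'a" +
  fixes n :: nat and q :: 'k and g :: "nat \<Rightarrow> 'a" and f :: "nat set set \<Rightarrow> 'a"
  assumes g_closed [simp]: "a \<in> {1..<n} \<Longrightarrow> g a \<in> carrier R"
    and f_closed [simp]: "A \<in> set_par n \<Longrightarrow> f A \<in> carrier R"
    and f_sum: "(\<Oplus>A\<in>set_par n. f A) = \<one>"
    and f_mult: "A \<in> set_par n \<Longrightarrow> B \<in> set_par n \<Longrightarrow> f A \<otimes> f B = (if A = B then f A else \<zero>)"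
    and g_f: "a \<in> {1..<n} \<Longrightarrow> A \<in> set_par n \<Longrightarrow> g a \<otimes> f A = f (sigma_act a A) \<otimes> g a"
    and g_square_apart: "a \<in> {1..<n} \<Longrightarrow> A \<in> set_par n \<Longrightarrow> \<not> same_block A a (a + 1) \<Longrightarrow>
      g a \<otimes> g a \<otimes> f A = sc q \<otimes> f A"
    and g_square_together: "a \<in> {1..<n} \<Longrightarrow> A \<in> set_par n \<Longrightarrow> same_block A a (a + 1) \<Longrightarrow>
      g a \<otimes> g a \<otimes> f A = (sc q \<oplus> sc (q - 1) \<otimes> g a) \<otimes> f A"
    and braid: "a \<in> {1..<n} \<Longrightarrow> b \<in> {1..<n} \<Longrightarrow> adjacent a b \<Longrightarrow>
      g a \<otimes> g b \<otimes> g a = g b \<otimes> g a \<otimes> g b"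
    and g_commute: "a \<in> {1..<n} \<Longrightarrow> b \<in> {1..<n} \<Longrightarrow> distant a b \<Longrightarrow> g a \<otimes> g b = g b \<otimes> g a"

context bt_family
begin

definition pairs :: "(nat \<times> nat) list" where
  "pairs = List.product [1..<Suc n] [1..<Suc n]"

definition partition_idem :: "nat set set \<Rightarrow> 'a" where
  "partition_idem A = atom (\<lambda>(i, j). tie i j) pairs (block_rel A)"

lemma set_pairs: "set pairs = {1..n} \<times> {1..n}"
  by (auto simp: pairs_def)

lemma tie_on_pairs: "(\<lambda>(i, j). tie i j) \<in> set pairs \<rightarrow> carrier R"
  by (auto simp: set_pairs)

lemma partition_idem_closed [simp]: "partition_idem A \<in> carrier R"
  unfolding partition_idem_def using tie_on_pairs by simp

lemma tie_atom:
  assumes i: "i \<in> {1..n}" and j: "j \<in> {1..n}"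
  shows "tie i j \<otimes> atom (\<lambda>(i, j). tie i j) pairs S =
    (if (i, j) \<in> S then atom (\<lambda>(i, j). tie i j) pairs S else \<zero>)"
proof -
  have "(i, j) \<in> set pairs"
    using i j by (simp add: set_pairs)
  from atom_absorb[OF tie_on_pairs this, of S] show ?thesis
    using tie_idem[OF i j] tie_commute[OF i j] by (force simp: set_pairs)
qed

lemma tie_partition_idem:
  assumes "i \<in> {1..n}" "j \<in> {1..n}"
  shows "tie i j \<otimes> partition_idem A = (if same_block A i j then partition_idem A else \<zero>)"
  using tie_atom[OF assms, of "block_rel A"] by (simp add: partition_idem_def block_rel_def)

lemma partition_idem_tie:
  assumes "i \<in> {1..n}" "j \<in> {1..n}"
  shows "partition_idem A \<otimes> tie i j = tie i j \<otimes> partition_idem A"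
  unfolding partition_idem_def
  using assms tie_commute by (intro commute_atom[symmetric] tie_on_pairs) (auto simp: set_pairs)

lemma partition_idem_fixes:
  assumes "y \<in> carrier R"
    and "\<And>i j. i \<in> {1..n} \<Longrightarrow> j \<in> {1..n} \<Longrightarrow> tie i j \<otimes> y = (if same_block A i j then y else \<zero>)"
  shows "partition_idem A \<otimes> y = y"
  unfolding partition_idem_def
  using assms by (intro atom_fixes tie_on_pairs) (auto simp: set_pairs block_rel_def)

text \<open>
  If \<open>S\<close> violates reflexivity, symmetry or transitivity, then the corresponding identity
  between ties makes the atom of \<open>S\<close> equal to its product with a tie that kills it.
\<close>

lemma atom_eq_zero:
  assumes "S \<subseteq> {1..n} \<times> {1..n}" and "S \<notin> block_rel ` set_par n"
  shows "atom (\<lambda>(i, j). tie i j) pairs S = \<zero>"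
proof -
  let ?z = "atom (\<lambda>(i, j). tie i j) pairs S"
  have z [simp]: "?z \<in> carrier R"
    using tie_on_pairs by simp
  have "\<not> equiv {1..n} S"
    using block_rel_quotient[of n S] assms(2) by (metis image_eqI)
  then consider i where "i \<in> {1..n}" "(i, i) \<notin> S"
    | i j where "(i, j) \<in> S" "(j, i) \<notin> S"
    | i j k where "(i, j) \<in> S" "(j, k) \<in> S" "(i, k) \<notin> S"
    using assms(1) unfolding equiv_def refl_on_def sym_def trans_def by blast
  then show ?thesis
  proof cases
    case 1
    then show ?thesis
      using tie_atom[of i i S] by simp
  next
    case 2
    then have "i \<in> {1..n}" "j \<in> {1..n}"
      using assms(1) by auto
    then show ?thesis
      using 2 tie_atom[of i j S] tie_atom[of j i S] by (simp add: tie_sym[of j i])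
  next
    case 3
    then have ijk: "i \<in> {1..n}" "j \<in> {1..n}" "k \<in> {1..n}"
      using assms(1) by auto
    have "?z = tie i j \<otimes> (tie j k \<otimes> ?z)"
      using 3 ijk by (simp only: tie_atom if_True)
    also have "\<dots> = tie i j \<otimes> (tie i k \<otimes> ?z)"
      using ijk tie_trans[OF ijk] by (simp only: tie_closed z flip: m_assoc)
    also have "\<dots> = \<zero>"
      using 3 ijk by (simp only: tie_atom if_False tie_closed r_null)
    finally show ?thesis .
  qed
qed

lemma partition_idem_sum: "(\<Oplus>A\<in>set_par n. partition_idem A) = \<one>"
proof -
  let ?at = "atom (\<lambda>(i, j). tie i j) pairs"
  have cl: "?at S \<in> carrier R" for S
    using tie_on_pairs by simp
  have sub: "block_rel ` set_par n \<subseteq> Pow ({1..n} \<times> {1..n})"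
    using same_block_mem by (fastforce simp: block_rel_def)
  have "inj_on block_rel (set_par n)"
    by (metis inj_onI quotient_block_rel)
  then have "(\<Oplus>A\<in>set_par n. partition_idem A) = (\<Oplus>S\<in>block_rel ` set_par n. ?at S)"
    unfolding partition_idem_def using cl by (intro finsum_reindex[symmetric]) auto
  also have "\<dots> = (\<Oplus>S\<in>Pow ({1..n} \<times> {1..n}). ?at S)"
    using sub cl atom_eq_zero by (intro add.finprod_mono_neutral_cong_left) auto
  also have "\<dots> = \<one>"
    using atom_sum[OF _ tie_on_pairs] by (simp add: set_pairs) (simp add: pairs_def distinct_product)
  finally show ?thesis .
qed

text \<open>
  Two partitions differ in some pair \<open>(i, j)\<close>; inserting \<open>tie i j\<close> between the two idempotents
  shows that their product equals zero.
\<close>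

lemma partition_idem_mult:
  assumes A: "A \<in> set_par n" and B: "B \<in> set_par n"
  shows "partition_idem A \<otimes> partition_idem B = (if A = B then partition_idem A else \<zero>)"
proof (cases "A = B")
  case True
  have "partition_idem A \<otimes> partition_idem A = partition_idem A"
    by (intro partition_idem_fixes tie_partition_idem) auto
  with True show ?thesis
    by simp
next
  case False
  then have "block_rel A \<noteq> block_rel B"
    using quotient_block_rel[OF A] quotient_block_rel[OF B] by metis
  then obtain i j where ij: "same_block A i j \<noteq> same_block B i j"
    by (auto simp: block_rel_def)
  then have mem: "i \<in> {1..n}" "j \<in> {1..n}"
    using same_block_mem A B by metis+
  have "(partition_idem A \<otimes> tie i j) \<otimes> partition_idem B = partition_idem A \<otimes> (tie i j \<otimes> partition_idem B)"
    using mem by (simp add: m_assoc)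
  then have "(if same_block A i j then partition_idem A else \<zero>) \<otimes> partition_idem B =
      partition_idem A \<otimes> (if same_block B i j then partition_idem B else \<zero>)"
    unfolding partition_idem_tie[OF mem] tie_partition_idem[OF mem] .
  then show ?thesis
    using ij False by (cases "same_block A i j") auto
qed

text \<open>
  The ties act on \<open>y = T\<^sub>a (partition_idem A)\<close> by the scalars that belong to \<open>\<sigma>\<^sub>a A\<close>, and this
  should characterise \<open>z = partition_idem (\<sigma>\<^sub>a A)\<close>. Indeed it gives \<open>z y = y\<close>; the same
  reasoning for the inverse of \<open>T\<^sub>a\<close> gives \<open>y z = z\<close>; and \<open>y\<close> and \<open>z\<close> commute.
\<close>

lemma T_partition_idem:
  assumes a: "a \<in> {1..<n}"
  shows "T a (partition_idem A) = partition_idem (sigma_act a A)"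
proof -
  let ?s = "transpose a (Suc a)"
  let ?y = "T a (partition_idem A)" and ?z = "partition_idem (sigma_act a A)"
  have y [simp]: "?y \<in> carrier R"
    using a by simp
  have inv: "inv (g a) \<in> Units R"
    using a by simp
  have T_inv: "T a (conjugate (inv (g a)) x) = x" if "x \<in> carrier R" for x
    using a that inv by (simp add: conjugate_comp) (simp add: conjugate_def)
  have tie_T: "tie i j \<otimes> T a x = T a (tie (?s i) (?s j) \<otimes> x)"
      "T a x \<otimes> tie i j = T a (x \<otimes> tie (?s i) (?s j))"
    if "i \<in> {1..n}" "j \<in> {1..n}" "x \<in> carrier R" for i j x
    using that a transpose_mem[OF a] T_tie[OF a, of "?s i" "?s j"] by (simp_all add: conjugate_mult)
  have tie_y: "tie i j \<otimes> ?y = (if same_block (sigma_act a A) i j then ?y else \<zero>)"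
    if ij: "i \<in> {1..n}" "j \<in> {1..n}" for i j
    using a tie_T(1)[OF ij] tie_partition_idem[OF transpose_mem[OF a ij(1)] transpose_mem[OF a ij(2)]]
    by (simp add: same_block_sigma_act)
  then have zy: "?z \<otimes> ?y = ?y"
    by (intro partition_idem_fixes) auto
  (* The preimage of z under T a; the ties act on it by the scalars of A. *)
  define w where "w = conjugate (inv (g a)) ?z"
  have w: "w \<in> carrier R" "T a w = ?z"
    using inv T_inv by (simp_all add: w_def)
  have "tie i j \<otimes> w = (if same_block A i j then w else \<zero>)"
    if ij: "i \<in> {1..n}" "j \<in> {1..n}" for i j
  proof -
    have "T a (tie i j \<otimes> w) = tie (?s i) (?s j) \<otimes> ?z"
      using tie_T(1)[OF transpose_mem[OF a ij(1)] transpose_mem[OF a ij(2)] w(1)] w(2) by simp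
    also have "\<dots> = T a (if same_block A i j then w else \<zero>)"
      using a w tie_partition_idem[OF transpose_mem[OF a ij(1)] transpose_mem[OF a ij(2)]]
      by (simp add: same_block_sigma_act)
    finally show ?thesis
      using a w ij by (simp add: conjugate_eq_iff)
  qed
  then have "partition_idem A \<otimes> w = w"
    using w by (intro partition_idem_fixes) auto
  then have yz: "?y \<otimes> ?z = ?z"
    using a w by (metis conjugate_mult g_unit partition_idem_closed)
  have "?y \<otimes> tie i j = tie i j \<otimes> ?y" if ij: "i \<in> {1..n}" "j \<in> {1..n}" for i j
    using tie_T[OF ij partition_idem_closed]
      partition_idem_tie[OF transpose_mem[OF a ij(1)] transpose_mem[OF a ij(2)]] by simp
  then have "?y \<otimes> ?z = ?z \<otimes> ?y"
    unfolding partition_idem_def[of "sigma_act a A"]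
    by (intro commute_atom tie_on_pairs y) (auto simp: set_pairs)
  with zy yz show ?thesis
    by simp
qed

lemma e_partition_idem:
  assumes "a \<in> {1..<n}"
  shows "e a \<otimes> partition_idem A = (if same_block A a (a + 1) then partition_idem A else \<zero>)"
  using tie_partition_idem[of a "Suc a" A] assms by (simp add: tie_Suc)

text \<open>
  Multiplied by an idempotent, the quadratic relation splits into two cases, since \<open>e\<^sub>a\<close>
  acts on it as \<open>1\<close> or \<open>0\<close>.
\<close>

lemma partition_idem_family: "idem_family R sc n q g partition_idem"
proof unfold_locales
  fix a A assume a: "a \<in> {1..<n}"
  note cl [simp] = g_closed[OF a] e_closed[OF a]
  have "g a \<otimes> g a \<otimes> partition_idem A =
      sc q \<otimes> partition_idem A \<oplus> sc (q - 1) \<otimes> (g a \<otimes> (e a \<otimes> partition_idem A))"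
    by (simp add: g_square[OF a] l_distr m_assoc g_e[OF a, symmetric])
  then have sq: "g a \<otimes> g a \<otimes> partition_idem A = sc q \<otimes> partition_idem A \<oplus>
      sc (q - 1) \<otimes> (g a \<otimes> (if same_block A a (a + 1) then partition_idem A else \<zero>))"
    unfolding e_partition_idem[OF a] .
  show "g a \<otimes> g a \<otimes> partition_idem A = sc q \<otimes> partition_idem A"
    if "\<not> same_block A a (a + 1)"
    unfolding sq using that by simp
  show "g a \<otimes> g a \<otimes> partition_idem A = (sc q \<oplus> sc (q - 1) \<otimes> g a) \<otimes> partition_idem A"
    if "same_block A a (a + 1)"
    unfolding sq using that by (simp add: l_distr m_assoc)
  show "g a \<otimes> partition_idem A = partition_idem (sigma_act a A) \<otimes> g a"
    using conjugate_swap[of "g a" "partition_idem A"] a by (simp add: T_partition_idem)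
qed (rule braid g_commute partition_idem_sum partition_idem_mult g_closed partition_idem_closed;
    assumption)+

text \<open>
  Multiply the decomposition of \<open>\<one>\<close> by \<open>e\<^sub>a\<close>; exactly the stated summands survive.
\<close>

lemma sum_partition_idem_eq_e:
  assumes a: "a \<in> {1..<n}"
  shows "(\<Oplus>A\<in>{A \<in> set_par n. same_block A a (a + 1)}. partition_idem A) = e a"
proof -
  have "(\<Oplus>A\<in>{A \<in> set_par n. same_block A a (a + 1)}. partition_idem A) =
      (\<Oplus>A\<in>set_par n. e a \<otimes> partition_idem A)"
    using finite_set_par a
    by (intro add.finprod_mono_neutral_cong_left) (auto simp: e_partition_idem)
  also have "\<dots> = e a \<otimes> (\<Oplus>A\<in>set_par n. partition_idem A)"
    using a finite_set_par by (intro finsum_rdistr[symmetric]) auto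
  finally show ?thesis
    using a by (simp add: partition_idem_sum)
qed

end

section \<open>From orthogonal idempotents to ties\<close>

context idem_family
begin

text \<open>
  Sums of orthogonal idempotents, indexed by properties of partitions: they turn
  conjunction into multiplication. The sum \<open>joined i j\<close> will play the role of \<open>tie i j\<close>.
\<close>

definition block_sum :: "(nat set set \<Rightarrow> bool) \<Rightarrow> 'a" where
  "block_sum P = (\<Oplus>A\<in>{A \<in> set_par n. P A}. f A)"

abbreviation joined :: "nat \<Rightarrow> nat \<Rightarrow> 'a" where
  "joined i j \<equiv> block_sum (\<lambda>A. same_block A i j)"

lemma block_sum_closed [simp]: "block_sum P \<in> carrier R"
  unfolding block_sum_def by (intro finsum_closed) auto

lemma block_sum_cong: "(\<And>A. A \<in> set_par n \<Longrightarrow> P A \<longleftrightarrow> P' A) \<Longrightarrow> block_sum P = block_sum P'"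
  unfolding block_sum_def by (metis (mono_tags, lifting) Collect_cong)

lemma block_sum_indicator: "block_sum P = (\<Oplus>A\<in>set_par n. if P A then f A else \<zero>)"
  unfolding block_sum_def
  using finite_set_par by (intro add.finprod_mono_neutral_cong_left) auto

lemma block_sum_True: "block_sum (\<lambda>A. True) = \<one>"
  by (simp add: block_sum_indicator f_sum)

lemma block_sum_f:
  assumes B: "B \<in> set_par n"
  shows "block_sum P \<otimes> f B = (if P B then f B else \<zero>)"
proof -
  have "block_sum P \<otimes> f B = (\<Oplus>A\<in>set_par n. (if P A then f A else \<zero>) \<otimes> f B)"
    unfolding block_sum_indicator using finite_set_par B by (intro finsum_ldistr) auto
  also have "\<dots> = (\<Oplus>A\<in>set_par n. if B = A then (if P A then f A else \<zero>) else \<zero>)"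
    using B by (intro finsum_cong') (auto simp: f_mult)
  also have "\<dots> = (if P B then f B else \<zero>)"
    using B finite_set_par by (intro finsum_singleton) auto
  finally show ?thesis .
qed

text \<open>
  The idempotents add up to \<open>\<one>\<close>, so an element is the sum of its products with them.
\<close>

lemma eqI_on_idems:
  assumes x: "x \<in> carrier R" and y: "y \<in> carrier R"
    and xy: "\<And>A. A \<in> set_par n \<Longrightarrow> x \<otimes> f A = y \<otimes> f A"
  shows "x = y"
proof -
  have "x = (\<Oplus>A\<in>set_par n. x \<otimes> f A)" if "x \<in> carrier R" for x
    using that finite_set_par f_sum finsum_rdistr[of "set_par n" x f] by auto
  then have "x = (\<Oplus>A\<in>set_par n. x \<otimes> f A)" "y = (\<Oplus>A\<in>set_par n. y \<otimes> f A)"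
    using x y by auto
  moreover have "(\<Oplus>A\<in>set_par n. x \<otimes> f A) = (\<Oplus>A\<in>set_par n. y \<otimes> f A)"
    using xy y by (intro finsum_cong') auto
  ultimately show ?thesis
    by simp
qed

lemma block_sum_mult: "block_sum P \<otimes> block_sum P' = block_sum (\<lambda>A. P A \<and> P' A)"
  by (rule eqI_on_idems) (auto simp: block_sum_f m_assoc)

lemma g_block_sum:
  assumes a: "a \<in> {1..<n}"
  shows "g a \<otimes> block_sum P = block_sum (\<lambda>A. P (sigma_act a A)) \<otimes> g a"
proof (rule eqI_on_idems)
  fix A assume A: "A \<in> set_par n"
  have A': "sigma_act a A \<in> set_par n"
    using A a by (rule sigma_act_set_par)
  have "block_sum (\<lambda>A. P (sigma_act a A)) \<otimes> g a \<otimes> f A =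
      block_sum (\<lambda>A. P (sigma_act a A)) \<otimes> f (sigma_act a A) \<otimes> g a"
    using A A' a g_f[OF a A] by (simp add: m_assoc)
  also have "\<dots> = (if P A then g a \<otimes> f A else \<zero>)"
    using A A' a g_f[OF a A] by (simp add: block_sum_f sigma_act_twice)
  finally show "g a \<otimes> block_sum P \<otimes> f A = block_sum (\<lambda>A. P (sigma_act a A)) \<otimes> g a \<otimes> f A"
    using A a by (simp add: m_assoc block_sum_f)
qed (use a in auto)

lemma g_joined:
  assumes "a \<in> {1..<n}"
  shows "g a \<otimes> joined i j = joined (transpose a (Suc a) i) (transpose a (Suc a) j) \<otimes> g a"
  using g_block_sum[OF assms, of "\<lambda>A. same_block A i j"] by (simp add: same_block_sigma_act)

lemma joined_sym: "joined i j = joined j i"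
  by (rule block_sum_cong) (rule same_block_sym)

lemma joined_refl: "i \<in> {1..n} \<Longrightarrow> joined i i = \<one>"
  using block_sum_cong[of "\<lambda>A. same_block A i i" "\<lambda>A. True"]
  by (simp add: same_block_refl block_sum_True)

lemma joined_trans: "joined i j \<otimes> joined j k = joined i j \<otimes> joined i k"
  unfolding block_sum_mult by (rule block_sum_cong) (metis same_block_trans)

lemma joined_commute: "joined i j \<otimes> joined k l = joined k l \<otimes> joined i j"
  unfolding block_sum_mult by (rule block_sum_cong) auto

text \<open>
  As \<open>g\<^sub>a\<close> permutes the idempotents by \<open>\<sigma>\<^sub>a\<close>, every relation reduces to a property of the relation
  of lying in the same block: symmetry, transitivity, or the effect of \<open>\<sigma>\<^sub>a\<close> on a pair. The
  quadratic relation is the combination of its two cases.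
\<close>

lemma joined_family:
  assumes q: "q \<noteq> 0" "q \<noteq> 1"
  shows "bt_family R sc n q g (\<lambda>a. joined a (Suc a))"
proof
  fix a assume a: "a \<in> {1..<n}"
  note cl [simp] = g_closed[OF a]
  show "g a \<otimes> joined a (Suc a) = joined a (Suc a) \<otimes> g a"
    using g_joined[OF a, of a "Suc a"] by (simp add: joined_sym)
  show "g a \<otimes> g a = sc q \<oplus> sc (q - 1) \<otimes> joined a (Suc a) \<otimes> g a"
  proof (rule eqI_on_idems)
    fix A assume A: "A \<in> set_par n"
    have "joined a (Suc a) \<otimes> g a \<otimes> f A = g a \<otimes> (joined a (Suc a) \<otimes> f A)"
      using A g_joined[OF a, of a "Suc a"] by (simp add: joined_sym flip: m_assoc)
    then have "(sc q \<oplus> sc (q - 1) \<otimes> joined a (Suc a) \<otimes> g a) \<otimes> f A =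
        sc q \<otimes> f A \<oplus> sc (q - 1) \<otimes> (g a \<otimes> (if same_block A a (a + 1) then f A else \<zero>))"
      using A by (simp add: block_sum_f l_distr m_assoc)
    then show "g a \<otimes> g a \<otimes> f A = (sc q \<oplus> sc (q - 1) \<otimes> joined a (Suc a) \<otimes> g a) \<otimes> f A"
      using A g_square_apart[OF a A] g_square_together[OF a A] by (simp add: l_distr m_assoc)
  qed auto
next
  fix a b assume a: "a \<in> {1..<n}" and b: "b \<in> {1..<n}"
  note cl [simp] = g_closed[OF a] g_closed[OF b]
  show "joined a (Suc a) \<otimes> joined b (Suc b) = joined b (Suc b) \<otimes> joined a (Suc a)"
    by (rule joined_commute)
  show "g a \<otimes> joined b (Suc b) = joined b (Suc b) \<otimes> g a" if "distant a b"
    using that g_joined[OF a, of b "Suc b"] by (auto simp: distant_def transpose_def)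
  assume ab: "adjacent a b"
  then have cases: "b = Suc a \<or> a = Suc b"
    unfolding adjacent_def by arith
  let ?x = "transpose a (Suc a) b" and ?y = "transpose a (Suc a) (Suc b)"
  have "g b \<otimes> (g a \<otimes> joined b (Suc b)) = g b \<otimes> joined ?x ?y \<otimes> g a"
    using g_joined[OF a, of b "Suc b"] by (simp add: m_assoc)
  also have "\<dots> = joined (transpose b (Suc b) ?x) (transpose b (Suc b) ?y) \<otimes> (g b \<otimes> g a)"
    using g_joined[OF b, of ?x ?y] by (simp add: m_assoc)
  also have "joined (transpose b (Suc b) ?x) (transpose b (Suc b) ?y) = joined a (Suc a)"
    using cases by (auto simp: joined_sym)
  finally have "g b \<otimes> (g a \<otimes> joined b (Suc b)) = joined a (Suc a) \<otimes> (g b \<otimes> g a)" .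
  then show "joined a (Suc a) \<otimes> g b \<otimes> g a = g b \<otimes> g a \<otimes> joined b (Suc b)"
    by (simp add: m_assoc)
  have *: "joined a (Suc a) \<otimes> joined (transpose b (Suc b) a) (transpose b (Suc b) (Suc a)) =
      joined a (Suc a) \<otimes> joined b (Suc b)"
    using cases
  proof
    assume "b = Suc a"
    then show ?thesis
      using joined_trans[of a b "Suc b"] by simp
  next
    assume "a = Suc b"
    then show ?thesis
      using joined_trans[of "Suc a" a b] by (simp add: joined_sym)
  qed
  have gj: "g b \<otimes> joined a (Suc a) = joined (transpose b (Suc b) a) (transpose b (Suc b) (Suc a)) \<otimes> g b"
    using g_joined[OF b, of a "Suc a"] by simp
  show 1: "joined a (Suc a) \<otimes> joined b (Suc b) \<otimes> g b = joined a (Suc a) \<otimes> g b \<otimes> joined a (Suc a)"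
    unfolding *[symmetric] m_assoc[OF block_sum_closed block_sum_closed cl(2)] gj[symmetric]
    by (simp add: m_assoc)
  have "g b \<otimes> joined a (Suc a) \<otimes> joined b (Suc b) = g b \<otimes> joined b (Suc b) \<otimes> joined a (Suc a)"
    using joined_commute[of a "a + 1" b "b + 1"] by (simp add: m_assoc)
  also have "\<dots> = joined b (Suc b) \<otimes> (g b \<otimes> joined a (Suc a))"
    using g_joined[OF b, of b "Suc b"] by (simp add: joined_sym m_assoc)
  also have "\<dots> = joined b (Suc b) \<otimes> joined (transpose b (Suc b) a) (transpose b (Suc b) (Suc a)) \<otimes> g b"
    unfolding gj by (simp add: m_assoc)
  also have "joined b (Suc b) \<otimes> joined (transpose b (Suc b) a) (transpose b (Suc b) (Suc a)) =
      joined a (Suc a) \<otimes> joined b (Suc b)"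
    using cases
  proof
    assume "b = Suc a"
    then show ?thesis
      using joined_trans[of b "Suc b" a] by (simp add: joined_sym joined_commute)
  next
    assume "a = Suc b"
    then show ?thesis
      using joined_trans[of b a "Suc a"] by (simp add: joined_sym joined_commute)
  qed
  finally show "joined a (Suc a) \<otimes> g b \<otimes> joined a (Suc a) = g b \<otimes> joined a (Suc a) \<otimes> joined b (Suc b)"
    using 1 by simp
qed (use q in \<open>auto intro: braid g_commute simp: block_sum_mult\<close>)

end

context idem_family
begin

text \<open>
  Going from idempotents to ties and back. Conjugation by \<open>g\<^sub>i\<close> acts on the sums \<open>joined i j\<close>
  as it does on ties, so the two agree. Then the atom of a partition \<open>B\<close> fixes \<open>f B\<close>, and
  orthogonality of the atoms does the rest.
\<close>

lemma partition_idem_joined: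
  assumes q: "q \<noteq> 0" "q \<noteq> 1" and A: "A \<in> set_par n"
  shows "bt_family.partition_idem R n g (\<lambda>a. joined a (Suc a)) A = f A"
proof -
  interpret bt: bt_family R sc n q g "\<lambda>a. joined a (Suc a)"
    using q by (rule joined_family)
  have span: "bt.tie_span d i = joined i (i + d + 1)" if "1 \<le> i" "i + d < n" for d i
    using that
  proof (induction d arbitrary: i)
    case (Suc d)
    then have "bt.tie_span d (Suc i) = joined (Suc i) (i + Suc d + 1)"
      by simp
    moreover have "conjugate (g i) (joined (Suc i) (i + Suc d + 1)) = joined i (i + Suc d + 1)"
      using Suc.prems g_joined[of i "Suc i" "i + Suc d + 1"] by (intro conjugate_eqI) auto
    ultimately show ?case
      by simp
  qed simp
  have tie: "bt.tie i j = joined i j" if "i \<in> {1..n}" "j \<in> {1..n}" for i j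
  proof (cases i j rule: linorder_cases)
    case less
    then show ?thesis
      using that span[of i "j - i - 1"] by (simp add: bt.tie_def)
  next
    case equal
    then show ?thesis
      using that by (simp add: joined_refl)
  next
    case greater
    then show ?thesis
      using that span[of j "i - j - 1"] by (simp add: bt.tie_def joined_sym)
  qed
  have absorb: "bt.partition_idem B \<otimes> f B = f B" if "B \<in> set_par n" for B
    using that by (intro bt.partition_idem_fixes) (auto simp: tie block_sum_f)
  show ?thesis
  proof (rule eqI_on_idems)
    fix B assume B: "B \<in> set_par n"
    have "bt.partition_idem A \<otimes> f B = (bt.partition_idem A \<otimes> bt.partition_idem B) \<otimes> f B"
      using B by (simp add: m_assoc absorb)
    also have "\<dots> = f A \<otimes> f B"
      using A B by (simp add: bt.partition_idem_mult f_mult absorb)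
    finally show "bt.partition_idem A \<otimes> f B = f A \<otimes> f B" .
  qed (use A in auto)
qed

end

text \<open>
  The idempotent of a partition is built from the \<open>g\<close> and \<open>e\<close> by ring operations
  and inverses, and hence is preserved by homomorphisms.
\<close>

lemma hom_partition_idem:
  assumes "bt_family R sc n q g e" and "bt_family S sc' n q g' e'" and \<theta>: "\<theta> \<in> ring_hom R S"
    and g: "\<And>a. a \<in> {1..<n} \<Longrightarrow> \<theta> (g a) = g' a" and e: "\<And>a. a \<in> {1..<n} \<Longrightarrow> \<theta> (e a) = e' a"
  shows "\<theta> (bt_family.partition_idem R n g e A) = bt_family.partition_idem S n g' e' A"
proof -
  interpret A: bt_family R sc n q g e by fact
  interpret B: bt_family S sc' n q g' e' by fact
  interpret \<theta>: ring_hom_ring R S \<theta>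
    by (intro ring_hom_ringI2 A.ring_axioms B.ring_axioms \<theta>)
  have T: "\<theta> (A.T a x) = B.T a (\<theta> x)" if "a \<in> {1..<n}" "x \<in> carrier R" for a x
  proof -
    have "\<theta> (g a \<otimes>\<^bsub>R\<^esub> x) = \<theta> (A.T a x \<otimes>\<^bsub>R\<^esub> g a)"
      using that by (simp add: A.conjugate_swap)
    then show ?thesis
      using that by (intro B.conjugate_eqI[symmetric]) (auto simp: g)
  qed
  have span: "\<theta> (A.tie_span d i) = B.tie_span d i" if "1 \<le> i" "i + d < n" for d i
    using that by (induction d arbitrary: i) (auto simp: e T)
  have tie: "\<theta> (A.tie i j) = B.tie i j" if "i \<in> {1..n}" "j \<in> {1..n}" for i j
  proof (cases "i = j")
    case False
    then show ?thesis
      using that by (auto simp: A.tie_def B.tie_def intro!: span)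
  qed simp
  have "\<theta> (A.atom (\<lambda>(i, j). A.tie i j) xs S) = B.atom (\<lambda>(i, j). B.tie i j) xs S"
    if "set xs \<subseteq> {1..n} \<times> {1..n}" for xs S
    using that
  proof (induction xs)
    case (Cons x xs)
    obtain i j where x: "x = (i, j)" "i \<in> {1..n}" "j \<in> {1..n}"
      using Cons.prems by auto
    have u: "(\<lambda>(i, j). A.tie i j) \<in> set xs \<rightarrow> carrier R"
      using Cons.prems by auto
    then show ?case
      using Cons x A.atom_closed[OF u] A.tie_closed[OF x(2,3)] tie[OF x(2,3)]
      by (simp add: A.minus_eq B.minus_eq)
  qed simp
  moreover have "B.pairs = A.pairs"
    by (simp only: A.pairs_def B.pairs_def)
  ultimately show ?thesis
    by (simp add: A.partition_idem_def B.partition_idem_def A.set_pairs)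
qed

section \<open>The isomorphism\<close>

lemma bt_rels_free:
  "(l, r) \<in> bt_rels n q \<Longrightarrow>
     l \<in> carrier (free_algebra (bt_gens n)) \<and> r \<in> carrier (free_algebra (bt_gens n))"
  unfolding bt_rels_def
  by (elim UnE CollectE exE conjE)
     (simp_all add: free_algebra_closed bt_gens_def power2_eq_square)

lemma idem_rels_free:
  "(l, r) \<in> idem_rels n q \<Longrightarrow>
     l \<in> carrier (free_algebra (idem_gens n)) \<and> r \<in> carrier (free_algebra (idem_gens n))"
  unfolding idem_rels_def
  by (elim UnE CollectE exE conjE)
     (simp_all add: free_algebra_closed sum_free_algebra_closed sigma_act_set_par
        idem_gens_def power2_eq_square image_iff)

text \<open>
  Used in both directions: from left to right for the residue class map, to see that the
  generators of the bt-algebra satisfy the relations; from right to left for an evaluation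
  map, to construct a homomorphism out of the bt-algebra.
\<close>

lemma bt_rels_iff_family:
  assumes "free_algebra_rep R sc (bt_gens n) \<kappa>" and q: "q \<noteq> 0" "q \<noteq> 1"
    and g: "\<And>a. a \<in> {1..<n} \<Longrightarrow> \<kappa> (gg a) = g a" and e: "\<And>a. a \<in> {1..<n} \<Longrightarrow> \<kappa> (ee a) = e a"
  shows "(\<forall>(l, r) \<in> bt_rels n q. \<kappa> l = \<kappa> r) \<longleftrightarrow> bt_family R sc n q g e"
proof -
  interpret free_algebra_rep R sc "bt_gens n" \<kappa> by fact
  have [simp]: "gg a \<in> carrier (free_algebra (bt_gens n))" "ee a \<in> carrier (free_algebra (bt_gens n))"
    if "a \<in> {1..<n}" for a
    using that by (auto simp: free_algebra_closed bt_gens_def)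
  show ?thesis
  proof
    assume *: "\<forall>(l, r) \<in> bt_rels n q. \<kappa> l = \<kappa> r"
    have rel: "\<kappa> l = \<kappa> r" if "(l, r) \<in> bt_rels n q" for l r
      using * that by blast
    show "bt_family R sc n q g e"
    proof
      fix a assume a: "a \<in> {1..<n}"
      show "g a \<in> carrier R" "e a \<in> carrier R"
        using a rep_closed by (simp_all flip: g e)
      have "(gg a * ee a, ee a * gg a) \<in> bt_rels n q" "((ee a)^2, ee a) \<in> bt_rels n q"
          "((gg a)^2, scal q + scal (q - 1) * ee a * gg a) \<in> bt_rels n q"
        using a unfolding bt_rels_def by blast+
      from this[THEN rel] show "g a \<otimes>\<^bsub>R\<^esub> e a = e a \<otimes>\<^bsub>R\<^esub> g a" "e a \<otimes>\<^bsub>R\<^esub> e a = e a"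
          "g a \<otimes>\<^bsub>R\<^esub> g a = sc q \<oplus>\<^bsub>R\<^esub> sc (q - 1) \<otimes>\<^bsub>R\<^esub> e a \<otimes>\<^bsub>R\<^esub> g a"
        using a by (simp_all add: g e power2_eq_square free_algebra_closed(1-7) rep_scal)
    next
      fix a b assume a: "a \<in> {1..<n}" and b: "b \<in> {1..<n}"
      have "(ee a * ee b, ee b * ee a) \<in> bt_rels n q"
        using a b unfolding bt_rels_def by blast
      from this[THEN rel] show "e a \<otimes>\<^bsub>R\<^esub> e b = e b \<otimes>\<^bsub>R\<^esub> e a"
        using a b by (simp add: g e)
    next
      fix a b assume a: "a \<in> {1..<n}" and b: "b \<in> {1..<n}" and "distant a b"
      then have "(gg a * gg b, gg b * gg a) \<in> bt_rels n q" "(gg a * ee b, ee b * gg a) \<in> bt_rels n q"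
        unfolding bt_rels_def by blast+
      from this[THEN rel] show "g a \<otimes>\<^bsub>R\<^esub> g b = g b \<otimes>\<^bsub>R\<^esub> g a" "g a \<otimes>\<^bsub>R\<^esub> e b = e b \<otimes>\<^bsub>R\<^esub> g a"
        using a b by (simp_all add: g e)
    next
      fix a b assume a: "a \<in> {1..<n}" and b: "b \<in> {1..<n}" and "adjacent a b"
      then have "(gg a * gg b * gg a, gg b * gg a * gg b) \<in> bt_rels n q"
          "(ee a * gg b * gg a, gg b * gg a * ee b) \<in> bt_rels n q"
          "(ee a * ee b * gg b, ee a * gg b * ee a) \<in> bt_rels n q"
          "(ee a * gg b * ee a, gg b * ee a * ee b) \<in> bt_rels n q"
        unfolding bt_rels_def by blast+
      from this[THEN rel]
      show "g a \<otimes>\<^bsub>R\<^esub> g b \<otimes>\<^bsub>R\<^esub> g a = g b \<otimes>\<^bsub>R\<^esub> g a \<otimes>\<^bsub>R\<^esub> g b"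
          "e a \<otimes>\<^bsub>R\<^esub> g b \<otimes>\<^bsub>R\<^esub> g a = g b \<otimes>\<^bsub>R\<^esub> g a \<otimes>\<^bsub>R\<^esub> e b"
          "e a \<otimes>\<^bsub>R\<^esub> e b \<otimes>\<^bsub>R\<^esub> g b = e a \<otimes>\<^bsub>R\<^esub> g b \<otimes>\<^bsub>R\<^esub> e a"
          "e a \<otimes>\<^bsub>R\<^esub> g b \<otimes>\<^bsub>R\<^esub> e a = g b \<otimes>\<^bsub>R\<^esub> e a \<otimes>\<^bsub>R\<^esub> e b"
        using a b by (simp_all add: g e free_algebra_closed(1-7))
    qed (use q in auto)
  next
    assume "bt_family R sc n q g e"
    then interpret bt: bt_family R sc n q g e .
    have "\<kappa> l = \<kappa> r" if "(l, r) \<in> bt_rels n q" for l r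
      using that unfolding bt_rels_def
      by (elim UnE CollectE exE conjE Pair_inject;
          simp add: g e free_algebra_closed(1-7) power2_eq_square rep_scal)
        (rule bt.g_e bt.braid bt.g_commute bt.e_g_g bt.e_e_g bt.e_g_e bt.e_commute
            bt.g_e_commute bt.e_idem bt.g_square; simp)+
    then show "\<forall>(l, r) \<in> bt_rels n q. \<kappa> l = \<kappa> r"
      by blast
  qed
qed

lemma idem_rels_iff_family:
  assumes "free_algebra_rep R sc (idem_gens n) \<kappa>"
    and g: "\<And>a. a \<in> {1..<n} \<Longrightarrow> \<kappa> (gg a) = g a"
    and f: "\<And>A. A \<in> set_par n \<Longrightarrow> \<kappa> (ee A) = f A"
  shows "(\<forall>(l, r) \<in> idem_rels n q. \<kappa> l = \<kappa> r) \<longleftrightarrow> idem_family R sc n q g f"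
proof -
  interpret free_algebra_rep R sc "idem_gens n" \<kappa> by fact
  have gg [simp]: "gg a \<in> carrier (free_algebra (idem_gens n))" if "a \<in> {1..<n}" for a
    using that by (auto simp: free_algebra_closed idem_gens_def)
  have ee [simp]: "ee A \<in> carrier (free_algebra (idem_gens n))" if "A \<in> set_par n" for A
    using that by (auto simp: free_algebra_closed idem_gens_def)
  have \<kappa>_sum: "\<kappa> (\<Sum>A\<in>set_par n. ee A) = finsum R f (set_par n)"
    if "f \<in> set_par n \<rightarrow> carrier R"
  proof -
    have "\<kappa> (\<Sum>A\<in>set_par n. ee A) = (\<Oplus>\<^bsub>R\<^esub>A\<in>set_par n. \<kappa> (ee A))"
      using finite_set_par by (rule rep_sum) (rule ee)
    also have "\<dots> = finsum R f (set_par n)"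
      using that f by (intro finsum_cong') auto
    finally show ?thesis .
  qed
  show ?thesis
  proof
    assume *: "\<forall>(l, r) \<in> idem_rels n q. \<kappa> l = \<kappa> r"
    have rel: "\<kappa> l = \<kappa> r" if "(l, r) \<in> idem_rels n q" for l r
      using * that by blast
    have fc: "f A \<in> carrier R" if "A \<in> set_par n" for A
      using that rep_closed by (simp flip: f)
    show "idem_family R sc n q g f"
    proof
      show "g a \<in> carrier R" if "a \<in> {1..<n}" for a
        using that rep_closed by (simp flip: g)
      show "f A \<in> carrier R" if "A \<in> set_par n" for A
        by (rule fc[OF that])
      have "(\<Sum>A\<in>set_par n. ee A, 1) \<in> idem_rels n q"
        unfolding idem_rels_def by blast
      from this[THEN rel] show "finsum R f (set_par n) = \<one>\<^bsub>R\<^esub>"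
        using fc by (simp add: \<kappa>_sum)
    next
      fix A B assume A: "A \<in> set_par n" and B: "B \<in> set_par n"
      have "(ee A * ee B, if A = B then ee A else 0) \<in> idem_rels n q"
        using A B unfolding idem_rels_def by blast
      from this[THEN rel] show "f A \<otimes>\<^bsub>R\<^esub> f B = (if A = B then f A else \<zero>\<^bsub>R\<^esub>)"
        using A B by (simp add: f split: if_splits)
    next
      fix a A assume a: "a \<in> {1..<n}" and A: "A \<in> set_par n"
      have "(gg a * ee A, ee (sigma_act a A) * gg a) \<in> idem_rels n q"
        using a A unfolding idem_rels_def by blast
      from this[THEN rel] show "g a \<otimes>\<^bsub>R\<^esub> f A = f (sigma_act a A) \<otimes>\<^bsub>R\<^esub> g a"
        using a A sigma_act_set_par[OF A a] by (simp add: g f)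
      show "g a \<otimes>\<^bsub>R\<^esub> g a \<otimes>\<^bsub>R\<^esub> f A = sc q \<otimes>\<^bsub>R\<^esub> f A" if "\<not> same_block A a (a + 1)"
      proof -
        have "((gg a)^2 * ee A, scal q * ee A) \<in> idem_rels n q"
          using a A that unfolding idem_rels_def by blast
        from this[THEN rel] show ?thesis
          using a A by (simp add: g f power2_eq_square free_algebra_closed(1-7) rep_scal)
      qed
      show "g a \<otimes>\<^bsub>R\<^esub> g a \<otimes>\<^bsub>R\<^esub> f A = (sc q \<oplus>\<^bsub>R\<^esub> sc (q - 1) \<otimes>\<^bsub>R\<^esub> g a) \<otimes>\<^bsub>R\<^esub> f A"
        if "same_block A a (a + 1)"
      proof -
        have "((gg a)^2 * ee A, (scal q + scal (q - 1) * gg a) * ee A) \<in> idem_rels n q"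
          using a A that unfolding idem_rels_def by blast
        from this[THEN rel] show ?thesis
          using a A by (simp add: g f power2_eq_square free_algebra_closed(1-7) rep_scal)
      qed
    next
      fix a b assume a: "a \<in> {1..<n}" and b: "b \<in> {1..<n}" and "distant a b"
      then have "(gg a * gg b, gg b * gg a) \<in> idem_rels n q"
        unfolding idem_rels_def by blast
      from this[THEN rel] show "g a \<otimes>\<^bsub>R\<^esub> g b = g b \<otimes>\<^bsub>R\<^esub> g a"
        using a b by (simp add: g)
    next
      fix a b assume a: "a \<in> {1..<n}" and b: "b \<in> {1..<n}" and "adjacent a b"
      then have "(gg a * gg b * gg a, gg b * gg a * gg b) \<in> idem_rels n q"
        unfolding idem_rels_def by blast
      from this[THEN rel]
      show "g a \<otimes>\<^bsub>R\<^esub> g b \<otimes>\<^bsub>R\<^esub> g a = g b \<otimes>\<^bsub>R\<^esub> g a \<otimes>\<^bsub>R\<^esub> g b"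
        using a b by (simp add: g free_algebra_closed(1-7))
    qed
  next
    assume "idem_family R sc n q g f"
    then interpret idem: idem_family R sc n q g f .
    have "\<kappa> l = \<kappa> r" if "(l, r) \<in> idem_rels n q" for l r
      using that unfolding idem_rels_def
      by (elim UnE CollectE exE conjE singletonE Pair_inject;
          simp add: \<kappa>_sum Pi_iff idem.f_sum g f sigma_act_set_par free_algebra_closed(1-7)
            power2_eq_square rep_scal idem.f_mult idem.g_f)
        (rule idem.g_square_apart idem.g_square_together idem.braid idem.g_commute; simp)+
    then show "\<forall>(l, r) \<in> idem_rels n q. \<kappa> l = \<kappa> r"
      by blast
  qed
qed

text \<open>
  The homomorphism is induced by evaluation. The hypothesis on the relations is stated for
  every representation with the prescribed values on generators, so that it can be verified
  from these values alone.
\<close>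

lemma (in presentation) hom_from_generators:
  fixes B (structure)
  assumes "scalar_ring B sc" and f: "f \<in> X \<rightarrow> carrier B"
    and rel: "\<And>\<kappa>. free_algebra_rep B sc X \<kappa> \<Longrightarrow> (\<And>x. x \<in> X \<Longrightarrow> \<kappa> (gen x) = f x) \<Longrightarrow>
      \<forall>(l, r) \<in> Rel. \<kappa> l = \<kappa> r"
  shows "\<exists>\<theta> \<in> ring_hom Q B. (\<forall>c. \<theta> (cls (scal c)) = sc c) \<and> (\<forall>x \<in> X. \<theta> (cls (gen x)) = f x)"
proof -
  interpret B: scalar_ring B sc by fact
  (* Evaluation needs a value for every letter; letters outside X do not occur
     in the free algebra on X. *)
  define f' where "f' x = (if x \<in> X then f x else \<zero>)" for x
  have f': "f' \<in> UNIV \<rightarrow> carrier B"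
    using f by (auto simp: f'_def)
  have rep: "free_algebra_rep B sc X (B.eval f')"
    using f' by unfold_locales (auto intro: B.eval_ring_hom)
  moreover have "\<forall>(l, r) \<in> Rel. B.eval f' l = B.eval f' r"
    using f' by (intro rel[OF rep]) (auto simp: f'_def)
  ultimately obtain \<theta> where \<theta>: "\<theta> \<in> ring_hom Q B" "\<forall>p \<in> carrier F. \<theta> (cls p) = B.eval f' p"
    using universal_property[of B sc "B.eval f'"] by blast
  have "\<theta> (cls (scal c)) = sc c" for c
    using \<theta>(2) f' by (simp add: free_algebra_closed)
  moreover have "\<theta> (cls (gen x)) = f x" if "x \<in> X" for x
    using that \<theta>(2) f' by (simp add: free_algebra_closed f'_def)
  ultimately show ?thesis
    using \<theta>(1) by blast
qed

theorem theorem29: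
  fixes n :: nat and q :: "'k::field"
  assumes "n \<ge> 1" and "q \<noteq> 0" and "q \<noteq> 1"
  shows "bt_algebra n q \<simeq>\<^sub>a\<^sub>l\<^sub>g idem_algebra n q"
proof -
  note q = assms(2,3)
  interpret A: presentation "bt_gens n" "bt_rels n q"
    by (rule presentation.intro) (rule bt_rels_free)
  interpret B: presentation "idem_gens n" "idem_rels n q"
    by (rule presentation.intro) (rule idem_rels_free)
  have "bt_family A.Q (\<lambda>c. A.cls (scal c)) n q (\<lambda>a. A.cls (gg a)) (\<lambda>a. A.cls (ee a))"
    using A.cls_relation
    by (intro bt_rels_iff_family[OF A.cls.free_algebra_rep_axioms q refl refl, THEN iffD1]) auto
  then interpret bt: bt_family A.Q "\<lambda>c. A.cls (scal c)" n q "\<lambda>a. A.cls (gg a)" "\<lambda>a. A.cls (ee a)" .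
  have "idem_family B.Q (\<lambda>c. B.cls (scal c)) n q (\<lambda>a. B.cls (gg a)) (\<lambda>P. B.cls (ee P))"
    using B.cls_relation
    by (intro idem_rels_iff_family[OF B.cls.free_algebra_rep_axioms refl refl, THEN iffD1]) auto
  then interpret idem: idem_family B.Q "\<lambda>c. B.cls (scal c)" n q "\<lambda>a. B.cls (gg a)" "\<lambda>P. B.cls (ee P)" .
  note joined = idem.joined_family[OF q]

  (* The ties of the second algebra are the sums over all partitions that join a and a + 1. *)
  define u where "u x = (case x of Braid a \<Rightarrow> B.cls (gg a) | Tie a \<Rightarrow> idem.joined a (Suc a))" for x
  have u: "u \<in> bt_gens n \<rightarrow> carrier B.Q"
    using idem.g_closed by (auto simp: u_def bt_gens_def)
  have "\<exists>\<theta> \<in> ring_hom A.Q B.Q. (\<forall>c. \<theta> (A.cls (scal c)) = B.cls (scal c)) \<and>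
      (\<forall>x \<in> bt_gens n. \<theta> (A.cls (gen x)) = u x)"
  proof (rule A.hom_from_generators[OF B.cls.scalar_ring_axioms u])
    fix \<kappa>
    assume "free_algebra_rep B.Q (\<lambda>c. B.cls (scal c)) (bt_gens n) \<kappa>"
      and "\<And>x. x \<in> bt_gens n \<Longrightarrow> \<kappa> (gen x) = u x"
    then show "\<forall>(l, r)\<in>bt_rels n q. \<kappa> l = \<kappa> r"
      using joined q by (subst bt_rels_iff_family) (auto simp: u_def bt_gens_def)
  qed
  then obtain \<theta> where \<theta>: "\<theta> \<in> ring_hom A.Q B.Q" "\<And>c. \<theta> (A.cls (scal c)) = B.cls (scal c)"
      and "\<And>x. x \<in> bt_gens n \<Longrightarrow> \<theta> (A.cls (gen x)) = u x"
    by blast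
  then have \<theta>_gens: "\<theta> (A.cls (gg a)) = B.cls (gg a)" "\<theta> (A.cls (ee a)) = idem.joined a (Suc a)"
    if "a \<in> {1..<n}" for a
    using that by (simp_all add: u_def bt_gens_def)

  (* The idempotents of the bt-algebra are the atoms that its ties generate. *)
  define v where "v x = (case x of Braid a \<Rightarrow> A.cls (gg a) | Tie P \<Rightarrow> bt.partition_idem P)" for x
  have v: "v \<in> idem_gens n \<rightarrow> carrier A.Q"
    using bt.g_closed by (auto simp: v_def idem_gens_def)
  have "\<exists>\<eta> \<in> ring_hom B.Q A.Q. (\<forall>c. \<eta> (B.cls (scal c)) = A.cls (scal c)) \<and>
      (\<forall>x \<in> idem_gens n. \<eta> (B.cls (gen x)) = v x)"
  proof (rule B.hom_from_generators[OF A.cls.scalar_ring_axioms v])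
    fix \<kappa>
    assume "free_algebra_rep A.Q (\<lambda>c. A.cls (scal c)) (idem_gens n) \<kappa>"
      and "\<And>x. x \<in> idem_gens n \<Longrightarrow> \<kappa> (gen x) = v x"
    then show "\<forall>(l, r)\<in>idem_rels n q. \<kappa> l = \<kappa> r"
      using bt.partition_idem_family by (subst idem_rels_iff_family) (auto simp: v_def idem_gens_def)
  qed
  then obtain \<eta> where \<eta>: "\<eta> \<in> ring_hom B.Q A.Q" "\<And>c. \<eta> (B.cls (scal c)) = A.cls (scal c)"
      and "\<And>x. x \<in> idem_gens n \<Longrightarrow> \<eta> (B.cls (gen x)) = v x"
    by blast
  then have \<eta>_gens: "\<And>a. a \<in> {1..<n} \<Longrightarrow> \<eta> (B.cls (gg a)) = A.cls (gg a)"
      "\<And>P. P \<in> set_par n \<Longrightarrow> \<eta> (B.cls (ee P)) = bt.partition_idem P"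
    by (simp_all add: v_def idem_gens_def)

  interpret \<eta>: ring_hom_ring B.Q A.Q \<eta>
    by (intro ring_hom_ringI2 B.rel_ideal.quotient_is_ring A.rel_ideal.quotient_is_ring \<eta>(1))
  have \<eta>_joined: "\<eta> (idem.joined a (Suc a)) = A.cls (ee a)" if a: "a \<in> {1..<n}" for a
  proof -
    let ?J = "{P \<in> set_par n. same_block P a (Suc a)}"
    have "\<eta> (idem.joined a (Suc a)) = finsum A.Q (\<eta> \<circ> (\<lambda>P. B.cls (ee P))) ?J"
      unfolding idem.block_sum_def by (rule \<eta>.hom_finsum) auto
    also have "\<dots> = finsum A.Q bt.partition_idem ?J"
      by (rule A.cls.finsum_cong') (auto simp: \<eta>_gens)
    finally have "\<eta> (idem.joined a (Suc a)) = finsum A.Q bt.partition_idem ?J" .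
    then show ?thesis
      using bt.sum_partition_idem_eq_e[OF a] by simp
  qed
  have \<eta>\<theta>: "\<eta> (\<theta> (A.cls (gen x))) = A.cls (gen x)" if x: "x \<in> bt_gens n" for x
  proof -
    consider a where "a \<in> {1..<n}" "x = Braid a" | a where "a \<in> {1..<n}" "x = Tie a"
      using x unfolding bt_gens_def by blast
    then show ?thesis
      by cases (simp_all only: \<theta>_gens \<eta>_gens \<eta>_joined)
  qed
  have \<theta>_idem: "\<theta> (bt.partition_idem P) = B.cls (ee P)" if P: "P \<in> set_par n" for P
    using hom_partition_idem[OF bt.bt_family_axioms joined \<theta>(1) \<theta>_gens]
      idem.partition_idem_joined[OF q P] by simp
  have \<theta>\<eta>: "\<theta> (\<eta> (B.cls (gen y))) = B.cls (gen y)" if y: "y \<in> idem_gens n" for y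
  proof -
    consider a where "a \<in> {1..<n}" "y = Braid a" | P where "P \<in> set_par n" "y = Tie P"
      using y unfolding idem_gens_def by blast
    then show ?thesis
      by cases (simp_all only: \<theta>_gens \<eta>_gens \<theta>_idem)
  qed
  show ?thesis
    unfolding bt_algebra_def idem_algebra_def
    by (rule presented_algebra_isoI[OF A.presentation_axioms B.presentation_axioms \<theta> \<eta> \<eta>\<theta> \<theta>\<eta>])
qed

end
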